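(* Let $x\ge0$ and $T\ge1$. Then $$R_3^{\mathrm{AU}}\le 2\gamma^2(\gamma+\varepsilon_0)^2C_3\left(1+2^3K_h^4+2^9\left(x^4+\frac{4!}{\gamma^4}\right)\right)\left(L_1L_0^2+\frac{2M}{\varepsilon_0^2}\right)\left(\log_2T+1\right).$$
   Context: Setting. $B$ is a standard Brownian motion on a filtered probability space $(\Omega,\mathcal F,\{\mathcal F_t\},\mathbb P)$ (adapted to $\{\mathcal F_t\}$, increments after $t$ independent of $\mathcal F_t$); $\theta<0$, $\sigma>0$, $\gamma:=-2\theta/\sigma^2$; $\underline{\gamma}>0$ is a known constant with $\underline{\gamma}\le\gamma$. Assumption on $h:\mathbb R\to[0,\infty)$: (i) $h$ is continuous; $h$ is strictly increasing on $[0,\infty)$; $h$ is continuously differentiable on $(-\infty,0)$ with $h'(x)<0$ there; (ii) $\lim_{x\to-\infty}h(x)=+\infty$; (iii) there is a constant $0<b<\underline{\gamma}/2$ with $\limsup_{x\to+\infty}h(x)/e^{bx}<+\infty$. Reflected Brownian motion. For $s\ge 0$ and $\mathcal F_s$-measurable (possibly random) $r$ and $y\ge r$, $(Z_r^{s,y},Y_r^{s,y})$ is the unique continuous adapted pair on $[s,\infty)$ with $Z_r^{s,y}(t)=y+\theta(t-s)+\sigma(B(t)-B(s))+Y_r^{s,y}(t)\ge r$, $Y_r^{s,y}$ nondecreasing, $Y_r^{s,y}(s)=0$, $\int_s^t\mathbf 1_{\{Z_r^{s,y}(u)>r\}}\,dY_r^{s,y}(u)=0$ for $t\ge s$. Write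 $Z_r:=Z_r^{0,x}$, where $x$ is the initial state; $\mathbb E_x$ is expectation with initial state $x$. Cost. $C(u,r):=u\int_r^\infty h(z)e^{-u(z-r)}\,dz$ and $F(u,r):=C(u,r)-h(r)$. For each $u\ge\underline{\gamma}$ the equation $F(u,r)=0$ has a unique solution $r\in\mathbb R$, which is negative; it is denoted $r(u)$. $r^*:=r(\gamma)$; it is the global minimizer of $C(\gamma,\cdot)$. Constants (all exist). $K_h>0$ is such that $r(u)\in(-K_h,0)$ for all $u\ge\underline{\gamma}$. $M$ is such that $C(\gamma,r)\le M$ for all $r\in[-K_h,0]$. $\varepsilon_0,\delta_0,L_0>0$ are such that for all $u_1,u_2\in(\gamma-\varepsilon_0,\gamma+\varepsilon_0)\cap[\underline{\gamma},\infty)$, $r(u_1),r(u_2)\in(r^*-\delta_0,r^*+\delta_0)\subseteq(-K_h,0)$ and $|r(u_1)-r(u_2)|\le L_0|u_1-u_2|$. $L_1$ is such that $0\le C(\gamma,r)-C(\gamma,r^* )\le L_1(r-r^* )^2$ for all $r\in[r^*-\delta_0,r^*+\delta_0]$. $C_3<\infty$ is such that for every $r\in[-K_h,0]$, $x\ge r$, $T\ge1$: $\mathbb E_x\big[\big|\frac1T\int_0^T(Z_r(t)-r)\,dt-\frac1\gamma\big|^2\big]\le C_3(1+|x|^4)/T$. AU algorithm. Let $\tau_k:=2^k-1$, $\Delta\tau_k:=2^k$, $k\ge0$. Set $\hat r_0:=0$, $X_0:=x$. Recursively for $k\ge 0$: on $[\tau_k,\tau_{k+1})$ set $Z^{\mathrm{AU}}(t):=Z^{\tau_k,X_k}_{\hat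 r_k}(t)$; then $\hat\gamma_{k+1}:=\max\{(\frac1{\Delta\tau_k}\int_{\tau_k}^{\tau_{k+1}}(Z^{\mathrm{AU}}(s)-\hat r_k)\,ds)^{-1},\underline{\gamma}\}$, $\hat r_{k+1}:=r(\hat\gamma_{k+1})$, $X_{k+1}:=\max\{Z^{\mathrm{AU}}(\tau_{k+1}-),\hat r_{k+1}\}$. Learning regret. For $T\ge1$ let $N:=\lfloor\log_2(T+1)\rfloor$. $R_3^{\mathrm{AU}}:=\mathbb E_x\big[\sum_{k=1}^N\int_{\tau_k}^{\tau_{k+1}}|C(\gamma,\hat r_k)-C(\gamma,r^* )|\,dt\big]$. *)

theory Defs
  imports "HOL-Probability.Probability" "HOL-Probability.Stopping_Time"
begin

(* Time is indexed by real, but only F t with t >= 0 is constrained to lie in M; a filtration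
   on [0, \<infinity>) extends to negative indices by F t = F 0. *)
definition filtered_prob_space :: "'a measure \<Rightarrow> (real \<Rightarrow> 'a measure) \<Rightarrow> bool" where
  "filtered_prob_space M F \<longleftrightarrow>
     prob_space M \<and> filtration (space M) F \<and> (\<forall>t\<ge>0. subalgebra M (F t))"

definition standard_BM ::
  "'a measure \<Rightarrow> (real \<Rightarrow> 'a measure) \<Rightarrow> (real \<Rightarrow> 'a \<Rightarrow> real) \<Rightarrow> bool" where
  "standard_BM M F B \<longleftrightarrow>
     (\<forall>t\<ge>0. B t \<in> borel_measurable (F t)) \<and>
     (AE \<omega> in M. B 0 \<omega> = 0) \<and>
     (\<forall>\<omega>\<in>space M. continuous_on {0..} (\<lambda>t. B t \<omega>)) \<and>
     (\<forall>s t. 0 \<le> s \<and> s < t \<longrightarrow>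
        distributed M lborel (\<lambda>\<omega>. B t \<omega> - B s \<omega>) (normal_density 0 (sqrt (t - s))) \<and>
        prob_space.indep_set M (sets (F s))
          (sets (vimage_algebra (space M) (\<lambda>\<omega>. B t \<omega> - B s \<omega>) borel)))"

(* The pair (Z, Y) is the Brownian motion started at time s in y, with drift th and volatility sg,
   reflected upwards at the barrier r; y and r are random variables. Only the values at times
   t >= s matter. The Stieltjes measure dY on [s, \<infinity>) is the interval measure of Y extended
   constantly to the left of s. *)
definition reflected_BM ::
  "(real \<Rightarrow> 'a measure) \<Rightarrow> (real \<Rightarrow> 'a \<Rightarrow> real) \<Rightarrow> real \<Rightarrow> real \<Rightarrow> 'a set \<Rightarrow>
   real \<Rightarrow> ('a \<Rightarrow> real) \<Rightarrow> ('a \<Rightarrow> real) \<Rightarrow>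
   (real \<Rightarrow> 'a \<Rightarrow> real) \<Rightarrow> (real \<Rightarrow> 'a \<Rightarrow> real) \<Rightarrow> bool" where
  "reflected_BM F B th sg \<Omega> s y r Z Y \<longleftrightarrow>
     y \<in> borel_measurable (F s) \<and> r \<in> borel_measurable (F s) \<and>
     (\<forall>t\<ge>s. Z t \<in> borel_measurable (F t) \<and> Y t \<in> borel_measurable (F t)) \<and>
     (\<forall>\<omega>\<in>\<Omega>.
        r \<omega> \<le> y \<omega> \<and>
        continuous_on {s..} (\<lambda>t. Z t \<omega>) \<and> continuous_on {s..} (\<lambda>t. Y t \<omega>) \<and>
        (\<forall>t\<ge>s. Z t \<omega> = y \<omega> + th * (t - s) + sg * (B t \<omega> - B s \<omega>) + Y t \<omega> \<and> r \<omega> \<le> Z t \<omega>) \<and>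
        mono_on {s..} (\<lambda>t. Y t \<omega>) \<and> Y s \<omega> = 0 \<and>
        (\<forall>t\<ge>s. (\<integral>\<^sup>+ u\<in>{s..t}. indicator {u. r \<omega> < Z u \<omega>} u
                   \<partial>interval_measure (\<lambda>u. Y (max s u) \<omega>)) = 0))"

definition holding_cost :: "(real \<Rightarrow> real) \<Rightarrow> real \<Rightarrow> bool" where
  "holding_cost h gl \<longleftrightarrow>
     (\<forall>x. 0 \<le> h x) \<and>
     continuous_on UNIV h \<and> strict_mono_on {0..} h \<and>
     (\<forall>x<0. h differentiable (at x)) \<and> continuous_on {..<0} (deriv h) \<and>
     (\<forall>x<0. deriv h x < 0) \<and>
     filterlim h at_top at_bot \<and>
     (\<exists>b. 0 < b \<and> b < gl / 2 \<and> Limsup at_top (\<lambda>x. ereal (h x / exp (b * x))) < \<infinity>)"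

definition C_cost :: "(real \<Rightarrow> real) \<Rightarrow> real \<Rightarrow> real \<Rightarrow> real" where
  "C_cost h u r = u * (LBINT z:{r..}. h z * exp (- u * (z - r)))"

definition F_cost :: "(real \<Rightarrow> real) \<Rightarrow> real \<Rightarrow> real \<Rightarrow> real" where
  "F_cost h u r = C_cost h u r - h r"

(* Under holding_cost h gl with gl > 0, the root exists and is unique for every u >= gl. *)
definition r_opt :: "(real \<Rightarrow> real) \<Rightarrow> real \<Rightarrow> real" where
  "r_opt h u = (THE r. F_cost h u r = 0)"

definition tau :: "nat \<Rightarrow> real" where
  "tau k = 2 ^ k - 1"

definition dtau :: "nat \<Rightarrow> real" where
  "dtau k = 2 ^ k"

(* ghat 0 is not constrained and never used. A vanishing time average, where the estimate
   would be 1 / 0, is given the estimate gl, since inverse 0 = 0. *)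
definition AU_algorithm ::
  "(real \<Rightarrow> 'a measure) \<Rightarrow> (real \<Rightarrow> 'a \<Rightarrow> real) \<Rightarrow> real \<Rightarrow> real \<Rightarrow> 'a set \<Rightarrow>
   (real \<Rightarrow> real) \<Rightarrow> real \<Rightarrow> real \<Rightarrow>
   (real \<Rightarrow> 'a \<Rightarrow> real) \<Rightarrow> (nat \<Rightarrow> 'a \<Rightarrow> real) \<Rightarrow> (nat \<Rightarrow> 'a \<Rightarrow> real) \<Rightarrow>
   (nat \<Rightarrow> 'a \<Rightarrow> real) \<Rightarrow> bool" where
  "AU_algorithm F B th sg \<Omega> h gl x Z ghat rhat X \<longleftrightarrow>
     (\<forall>\<omega>\<in>\<Omega>. rhat 0 \<omega> = 0 \<and> X 0 \<omega> = x) \<and>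
     (\<forall>k. \<exists>Zk Yk. reflected_BM F B th sg \<Omega> (tau k) (X k) (rhat k) Zk Yk \<and>
        (\<forall>\<omega>\<in>\<Omega>. \<forall>t\<in>{tau k..<tau (Suc k)}. Z t \<omega> = Zk t \<omega>)) \<and>
     (\<forall>k. \<forall>\<omega>\<in>\<Omega>.
        ghat (Suc k) \<omega> =
          max (inverse (1 / dtau k * (LBINT s:{tau k..<tau (Suc k)}. Z s \<omega> - rhat k \<omega>))) gl \<and>
        rhat (Suc k) \<omega> = r_opt h (ghat (Suc k) \<omega>) \<and>
        X (Suc k) \<omega> = max (Lim (at_left (tau (Suc k))) (\<lambda>t. Z t \<omega>)) (rhat (Suc k) \<omega>))"

(* The expectation of a nonnegative quantity, hence taken in [0, \<infinity>]. *)
definition R3_AU ::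
  "'a measure \<Rightarrow> (real \<Rightarrow> real) \<Rightarrow> real \<Rightarrow> (nat \<Rightarrow> 'a \<Rightarrow> real) \<Rightarrow> real \<Rightarrow> ennreal" where
  "R3_AU M h g rhat T =
     (\<integral>\<^sup>+ \<omega>. ennreal (\<Sum>k = 1..nat \<lfloor>log 2 (T + 1)\<rfloor>.
        LBINT t:{tau k..<tau (Suc k)}. \<bar>C_cost h g (rhat k \<omega>) - C_cost h g (r_opt h g)\<bar>) \<partial>M)"

end

theory Submission
  imports Defs
begin

text \<open>
The barrier used in period \<open>k\<close> is computed from the time average \<open>A\<close> of \<open>Z - r\<close> over period
\<open>k - 1\<close>, and \<open>A\<close> estimates \<open>1 / \<gamma>\<close>. Pathwise, the error of the estimated rate, cut off at \<open>\<epsilon>\<^sub>0\<close>,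
is at most \<open>\<gamma> (\<gamma> + \<epsilon>\<^sub>0) \<bar>A - 1 / \<gamma>\<bar>\<close> (\<open>estimate_error_le\<close>). The excess cost is at most quadratic
in this cut-off error: near \<open>\<gamma>\<close> by the local bounds with \<open>L\<^sub>0\<close> and \<open>L\<^sub>1\<close>, and elsewhere trivially,
by \<open>2 M\<close>. Hence the expected regret of period \<open>k\<close> is at most its length \<open>2 ^ k\<close> times a multiple
of the mean square of \<open>A - 1 / \<gamma>\<close>. This mean square is of order \<open>1 / 2 ^ (k - 1)\<close>, so each period
contributes at most a constant, and there are at most \<open>log 2 T + 1\<close> periods. Two facts are needed
to carry this out.

The mean-square bound with \<open>C\<^sub>3\<close> is given for deterministic starts at time \<open>0\<close>, whereas a period
starts at a later time in a random state with a random barrier. The Markov property that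
transports the bound (\<open>time_average_bound_from_random_start\<close>) is proved by discretisation instead
of by laws on path space. On a grid, reflection is Lindley's recursion, and a reflected path
exceeds the recursion by at most the oscillation of the driving path on one cell
(\<open>lindley_approx\<close>), so the end point and the time average are limits of the discrete ones. The
discrete process is a Markov chain whose transition operator does not depend on the starting time
(\<open>nn_integral_chain\<close>). To use the given bound, the reflected process with a deterministic start
must exist, which is Skorokhod's construction (\<open>reflected_path_exists\<close>, \<open>reflected_BM_exists\<close>).

The resulting bound involves the fourth moment of the state at the start of a period, which must
be bounded uniformly in \<open>k\<close> (\<open>AU_state_fourth_moment\<close>). All barriers lie in \<open>[- K\<^sub>h, 0]\<close>, so the
state is at least \<open>- K\<^sub>h\<close>, and it is at most \<open>x + R\<close> for the Brownian motion \<open>R\<close> started in and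
reflected at \<open>0\<close> (\<open>AU_state_le\<close>). The tail of \<open>R\<close> is dominated by that of its stationary law, the
exponential distribution with rate \<open>\<gamma>\<close>; for Lindley's recursion this is an induction on the steps
(\<open>lindley_exponential_tail\<close>), and Fatou's lemma passes to the limit.
\<close>


section \<open>Reflected paths\<close>

text \<open>The deterministic content of reflection, at a single outcome. Working path by path separates the order
arguments below from all questions of measurability. The driving path \<open>w\<close> enters only through its
increments, except that the path starts at \<open>y + w s\<close>.\<close>

locale reflected_path =
  fixes s :: real and w :: "real \<Rightarrow> real" and y r :: real and Z Y :: "real \<Rightarrow> real"
  assumes start_ge: "r \<le> y"
    and cont_Z: "continuous_on {s..} Z"
    and cont_Y: "continuous_on {s..} Y"
    and decomp: "\<And>t. s \<le> t \<Longrightarrow> Z t = y + w t + Y t"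
    and ge_barrier: "\<And>t. s \<le> t \<Longrightarrow> r \<le> Z t"
    and mono_Y: "mono_on {s..} Y"
    and Y_start: "Y s = 0"
    and complementarity: "\<And>t. s \<le> t \<Longrightarrow>
      (\<integral>\<^sup>+ u\<in>{s..t}. indicator {u. r < Z u} u \<partial>interval_measure (\<lambda>u. Y (max s u))) = 0"

lemma emeasure_pushing:
  fixes Y :: "real \<Rightarrow> real"
  assumes "continuous_on {s..} Y" "mono_on {s..} Y" "a \<le> t"
  shows "emeasure (interval_measure (\<lambda>u. Y (max s u))) {a<..t}
    = ennreal (Y (max s t) - Y (max s a))"
proof -
  have mono: "Y (max s p) \<le> Y (max s q)" if "p \<le> q" for p q
    using that by (intro mono_onD[OF assms(2)]) auto
  have cont: "continuous_on UNIV (\<lambda>u. Y (max s u))"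
    by (intro continuous_on_compose2[OF assms(1)] continuous_intros) auto
  show "emeasure (interval_measure (\<lambda>u. Y (max s u))) {a<..t}
    = ennreal (Y (max s t) - Y (max s a))"
    using assms(3) mono cont
    by (intro emeasure_interval_measure_Ioc)
      (auto intro: continuous_within_subset simp: continuous_on_eq_continuous_within)
qed

context reflected_path
begin

lemma cont_w: "continuous_on {s..} w"
proof -
  have "continuous_on {s..} (\<lambda>t. Z t - y - Y t)"
    by (intro continuous_intros cont_Z cont_Y)
  then show ?thesis
    by (rule continuous_on_eq) (auto simp: decomp)
qed

lemma w_start: "Z s = y + w s"
  using decomp[of s] Y_start by simp

lemma Y_le: "s \<le> a \<Longrightarrow> a \<le> t \<Longrightarrow> Y a \<le> Y t"
  by (rule mono_onD[OF mono_Y]) auto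

lemma increment_ge: "s \<le> a \<Longrightarrow> a \<le> t \<Longrightarrow> Z a + w t - w a \<le> Z t"
  using Y_le[of a t] decomp[of a] decomp[of t] by simp

text \<open>The Stieltjes measure of \<open>(a, t]\<close> is the increment of \<open>Y\<close>, and complementarity makes this interval
a null set. This is the form in which complementarity is used from here on.\<close>

lemma Y_constant_off_barrier:
  assumes "s \<le> a" "a \<le> t" and off: "\<And>u. a < u \<Longrightarrow> u \<le> t \<Longrightarrow> r < Z u"
  shows "Y t = Y a"
proof -
  let ?\<mu> = "interval_measure (\<lambda>u. Y (max s u))"
  have "ennreal (Y t - Y a) = emeasure ?\<mu> {a<..t}"
    using assms by (simp add: emeasure_pushing[OF cont_Y mono_Y])
  also have "\<dots> = (\<integral>\<^sup>+ u. indicator {a<..t} u \<partial>?\<mu>)"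
    by simp
  also have "\<dots> \<le> (\<integral>\<^sup>+ u\<in>{s..t}. indicator {u. r < Z u} u \<partial>?\<mu>)"
    using assms by (intro nn_integral_mono) (auto simp: indicator_def)
  also have "\<dots> = 0"
    using assms by (intro complementarity) auto
  finally show ?thesis
    using Y_le[of a t] assms by (auto simp: ennreal_eq_0_iff)
qed

text \<open>Look at the last time \<open>u\<close> in \<open>[a, t]\<close> at which the path is at most \<open>c\<close>: from then on it stays away
from the barrier and only follows its driving path. If there is no such time, this already holds
from \<open>a\<close> on. The level \<open>c = r\<close> compares the path with its discretisation, and \<open>c = 0\<close> compares paths with
different barriers \<open>r \<le> 0\<close>.\<close>

lemma excursion_cases:
  assumes "s \<le> a" "a \<le> t" "r \<le> c"
  shows "Z t = Z a + w t - w a \<or> (\<exists>u\<in>{a..t}. Z u \<le> c \<and> Z t = Z u + w t - w u)"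
proof (cases "\<exists>v\<in>{a..t}. Z v \<le> c")
  case False
  then have "Y t = Y a"
    using assms by (intro Y_constant_off_barrier) (auto simp: not_le intro: le_less_trans)
  then show ?thesis
    using assms decomp[of a] decomp[of t] by simp
next
  case True
  have cont: "continuous_on {a..t} Z"
    using assms by (intro continuous_on_subset[OF cont_Z]) auto
  \<comment> \<open>The compact set of times at level at most \<open>c\<close>; its maximum is the last such time.\<close>
  define K where "K = {v \<in> {a..t}. Z v \<le> c}"
  have "closed K"
    unfolding K_def using cont
    by (intro continuous_on_closed_Collect_le continuous_intros) auto
  moreover have "bounded K"
    by (rule bounded_subset[of "{a..t}"]) (auto simp: K_def)
  ultimately have "compact K"
    by (simp add: compact_eq_bounded_closed)
  then obtain u where u: "u \<in> K" "\<And>v. v \<in> K \<Longrightarrow> v \<le> u"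
    using True by (metis (lifting) K_def compact_attains_sup empty_iff mem_Collect_eq)
  have "Y t = Y u"
  proof (rule Y_constant_off_barrier)
    fix v assume v: "u < v" "v \<le> t"
    then have "v \<notin> K"
      using u(2)[of v] by auto
    then show "r < Z v"
      using v u(1) assms by (auto simp: K_def)
  qed (use u assms in \<open>auto simp: K_def\<close>)
  then show ?thesis
    using u(1) assms decomp[of u] decomp[of t] by (intro disjI2 bexI[of _ u]) (auto simp: K_def)
qed

end

section \<open>Discretisation by Lindley's recursion\<close>

text \<open>Lindley's recursion, the discrete-time form of reflection at \<open>0\<close>.\<close>

primrec lindley :: "real \<Rightarrow> (nat \<Rightarrow> real) \<Rightarrow> nat \<Rightarrow> real" where
  "lindley z d 0 = z"
| "lindley z d (Suc j) = max (lindley z d j + d j) 0"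

definition grid :: "real \<Rightarrow> real \<Rightarrow> nat \<Rightarrow> nat \<Rightarrow> real" where
  "grid s S n j = s + real j * (S / real n)"

lemma grid_mono: "0 \<le> S \<Longrightarrow> i \<le> j \<Longrightarrow> grid s S n i \<le> grid s S n j"
  by (simp add: grid_def mult_right_mono divide_right_mono)

lemma grid_0 [simp]: "grid s S n 0 = s"
  by (simp add: grid_def)

lemma grid_end: "0 < n \<Longrightarrow> grid s S n n = s + S"
  by (simp add: grid_def)

lemma grid_Suc: "grid s S n (Suc j) = grid s S n j + S / real n"
  by (simp add: grid_def distrib_right add_divide_distrib)

lemma grid_bounds: "0 \<le> S \<Longrightarrow> j \<le> n \<Longrightarrow> 0 < n \<Longrightarrow> s \<le> grid s S n j \<and> grid s S n j \<le> s + S"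
  using grid_mono[of S 0 j s n] grid_mono[of S j n s n] by (simp add: grid_end)

text \<open>Uniform continuity, phrased for grids with \<open>n\<close> cells. Including \<open>0 < n\<close> excludes the degenerate
grid, whose mesh \<open>S / 0\<close> is \<open>0\<close>.\<close>

lemma fine_grid:
  fixes f :: "real \<Rightarrow> real"
  assumes "continuous_on {s..s + S} f" "0 < e"
  shows "\<forall>\<^sub>F n in sequentially. 0 < n \<and>
    (\<forall>u\<in>{s..s + S}. \<forall>v\<in>{s..s + S}. \<bar>u - v\<bar> \<le> S / real n \<longrightarrow> \<bar>f u - f v\<bar> \<le> e)"
proof -
  have "uniformly_continuous_on {s..s + S} f"
    by (rule compact_uniformly_continuous) (use assms in auto)
  then obtain d where d: "d > 0"
    "\<And>u v. u \<in> {s..s + S} \<Longrightarrow> v \<in> {s..s + S} \<Longrightarrow> dist v u < d \<Longrightarrow> dist (f v) (f u) < e"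
    unfolding uniformly_continuous_on_def using assms(2) by metis
  have "(\<lambda>n. S / real n) \<longlonglongrightarrow> 0"
    by (rule lim_const_over_n)
  then have "\<forall>\<^sub>F n in sequentially. S / real n < d"
    using d(1) by (rule order_tendstoD)
  with eventually_gt_at_top[of 0] show ?thesis
    by eventually_elim (use d(2) in \<open>force simp: dist_real_def\<close>)
qed

lemma set_integral_Ico_eq_Icc:
  fixes f :: "real \<Rightarrow> real"
  assumes "continuous_on {a..b} f"
  shows "(LBINT t:{a..<b}. f t) = (LBINT t:{a..b}. f t)"
proof -
  have i: "set_integrable lborel {a..b} f"
    by (intro borel_integrable_atLeastAtMost' assms)
  then have i': "set_integrable lborel {a..<b} f"
    by (rule set_integrable_subset) auto
  have "AE t in lborel. t \<noteq> b"
    by (rule AE_lborel_singleton)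
  then show ?thesis
    unfolding set_lebesgue_integral_def
    using i i' unfolding set_integrable_def
    by (intro integral_cong_AE) (auto simp: indicator_def elim!: eventually_mono)
qed

lemma riemann_sum_tendsto:
  fixes f :: "real \<Rightarrow> real"
  assumes cont: "continuous_on {s..s + S} f" and S: "0 < S"
  shows "(\<lambda>n. (\<Sum>j<n. f (grid s S n (Suc j))) / real n)
    \<longlonglongrightarrow> 1 / S * (LBINT t:{s..<s + S}. f t)"
proof (rule LIMSEQ_I)
  fix e :: real assume "0 < e"
  have int: "f integrable_on {a..b}" if "s \<le> a" "b \<le> s + S" for a b
    using that by (intro integrable_continuous_real continuous_on_subset[OF cont]) auto
  have LB: "(LBINT t:{s..<s + S}. f t) = integral {s..s + S} f"
  proof -
    have "(LBINT t:{s..<s + S}. f t) = (LBINT t:{s..s + S}. f t)"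
      using cont by (rule set_integral_Ico_eq_Icc)
    also have "\<dots> = integral {s..s + S} f"
      by (intro set_borel_integral_eq_integral borel_integrable_atLeastAtMost' cont)
    finally show ?thesis .
  qed
  have "\<forall>\<^sub>F n in sequentially. 0 < n \<and>
      (\<forall>u\<in>{s..s + S}. \<forall>v\<in>{s..s + S}. \<bar>u - v\<bar> \<le> S / real n \<longrightarrow> \<bar>f u - f v\<bar> \<le> e / 2)"
    using \<open>0 < e\<close> by (intro fine_grid cont) auto
  then have "\<forall>\<^sub>F n in sequentially.
    norm ((\<Sum>j<n. f (grid s S n (Suc j))) / real n - 1 / S * (LBINT t:{s..<s + S}. f t)) < e"
  proof eventually_elim
    case (elim n)
    then have n: "0 < n" and osc: "\<And>u v. u \<in> {s..s + S} \<Longrightarrow> v \<in> {s..s + S} \<Longrightarrow>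
        \<bar>u - v\<bar> \<le> S / real n \<Longrightarrow> \<bar>f u - f v\<bar> \<le> e / 2"
      by blast+
    define d where "d = S / real n"
    have d: "0 < d" using n S by (simp add: d_def)
    have step: "\<bar>integral {s..grid s S n m} f - d * (\<Sum>j<m. f (grid s S n (Suc j)))\<bar>
      \<le> real m * (d * (e / 2))" if "m \<le> n" for m
      using that
    proof (induction m)
      case (Suc m)
      let ?a = "grid s S n m" and ?b = "grid s S n (Suc m)"
      have ab: "s \<le> ?a" "?a \<le> ?b" "?b \<le> s + S" "?b = ?a + d"
        using Suc.prems n S grid_bounds[of S m n s] grid_bounds[of S "Suc m" n s]
          grid_mono[of S m "Suc m" s n] by (auto simp: grid_Suc d_def)
      have split: "integral {s..?b} f = integral {s..?a} f + integral {?a..?b} f"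
        using ab by (intro Henstock_Kurzweil_Integration.integral_combine[symmetric] int) auto
      have "\<bar>integral {?a..?b} f - d * f ?b\<bar> \<le> d * (e / 2)"
      proof -
        have "integral {?a..?b} (\<lambda>t. f t - f ?b) = integral {?a..?b} f - d * f ?b"
          using ab d by (subst Henstock_Kurzweil_Integration.integral_diff) (auto intro!: int)
        moreover have "norm (integral {?a..?b} (\<lambda>t. f t - f ?b)) \<le> e / 2 * (?b - ?a)"
        proof (rule integral_bound)
          show "continuous_on {?a..?b} (\<lambda>t. f t - f ?b)"
            using ab by (intro continuous_intros continuous_on_subset[OF cont]) auto
          show "norm (f t - f ?b) \<le> e / 2" if "t \<in> {?a..?b}" for t
            using osc[of t ?b] that ab by (auto simp: d_def)
        qed (use ab in auto)
        ultimately show ?thesis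
          using ab by (simp add: mult.commute)
      qed
      moreover have "integral {s..?b} f - d * (\<Sum>j<Suc m. f (grid s S n (Suc j)))
        = (integral {s..?a} f - d * (\<Sum>j<m. f (grid s S n (Suc j))))
          + (integral {?a..?b} f - d * f ?b)"
        by (simp add: split distrib_left)
      moreover have "real (Suc m) * (d * (e / 2)) = real m * (d * (e / 2)) + d * (e / 2)"
        by (simp add: algebra_simps)
      ultimately show ?case
        using Suc by linarith
    qed simp
    have "\<bar>integral {s..s + S} f - d * (\<Sum>j<n. f (grid s S n (Suc j)))\<bar> \<le> real n * (d * (e / 2))"
      using step[of n] n by (simp add: grid_end)
    also have "\<dots> = S * (e / 2)"
      using n by (simp add: d_def)
    finally have bound: "\<bar>integral {s..s + S} f - d * (\<Sum>j<n. f (grid s S n (Suc j)))\<bar> \<le> S * (e / 2)" .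
    have "\<bar>(\<Sum>j<n. f (grid s S n (Suc j))) / real n - 1 / S * integral {s..s + S} f\<bar>
      = \<bar>integral {s..s + S} f - d * (\<Sum>j<n. f (grid s S n (Suc j)))\<bar> / S"
      using n S by (simp add: d_def abs_if field_simps)
    also have "\<dots> \<le> e / 2"
      using bound S by (simp add: field_simps)
    finally show ?case
      using \<open>0 < e\<close> unfolding LB by simp
  qed
  then show "\<exists>no. \<forall>n\<ge>no. norm ((\<Sum>j<n. f (grid s S n (Suc j))) / real n
      - 1 / S * (LBINT t:{s..<s + S}. f t)) < e"
    by (simp add: eventually_sequentially)
qed

context reflected_path
begin

definition grid_queue :: "real \<Rightarrow> nat \<Rightarrow> nat \<Rightarrow> real" where
  "grid_queue S n = lindley (Z s - r) (\<lambda>j. w (grid s S n (Suc j)) - w (grid s S n j))"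

text \<open>Both inequalities propagate from one grid point to the next. The recursion never exceeds the path,
because the path pushes at least as much as is needed at the grid points. Conversely, if the path
touches the barrier inside a cell, it can rise above it until the end of the cell by at most the
oscillation of \<open>w\<close>, and if it does not touch it, both change by the same increment. The
error therefore does not accumulate over the cells.\<close>

lemma lindley_approx:
  assumes S: "0 \<le> S" and n: "0 < n"
    and osc: "\<forall>u\<in>{s..s + S}. \<forall>v\<in>{s..s + S}. \<bar>u - v\<bar> \<le> S / real n \<longrightarrow> \<bar>w u - w v\<bar> \<le> e"
    and j: "j \<le> n"
  shows "grid_queue S n j \<le> Z (grid s S n j) - r \<and>
    Z (grid s S n j) - r \<le> grid_queue S n j + e"
  using j
proof (induction j)
  case 0
  have "0 \<le> e"
    using osc[rule_format, of s s] S by simp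
  then show ?case by (simp add: grid_queue_def)
next
  case (Suc j)
  let ?a = "grid s S n j" and ?b = "grid s S n (Suc j)"
  have ab: "s \<le> ?a" "?a \<le> ?b" "?b \<le> s + S" "?b = ?a + S / real n"
    using Suc.prems n S grid_bounds[of S j n s] grid_bounds[of S "Suc j" n s]
      grid_mono[of S j "Suc j" s n] by (auto simp: grid_Suc)
  have q: "grid_queue S n (Suc j) = max (grid_queue S n j + (w ?b - w ?a)) 0"
    by (simp add: grid_queue_def)
  then have q_ge: "grid_queue S n j + (w ?b - w ?a) \<le> grid_queue S n (Suc j)"
    "0 \<le> grid_queue S n (Suc j)"
    by simp_all
  have lower: "grid_queue S n (Suc j) \<le> Z ?b - r"
    using Suc increment_ge[of ?a ?b] ge_barrier[of ?b] ab by (simp add: q)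
  moreover have "Z ?b - r \<le> grid_queue S n (Suc j) + e"
    using excursion_cases[of ?a ?b r]
  proof
    assume "Z ?b = Z ?a + w ?b - w ?a"
    then show ?thesis
      using Suc q_ge by simp
  next
    assume "\<exists>u\<in>{?a..?b}. Z u \<le> r \<and> Z ?b = Z u + w ?b - w u"
    then obtain u where u: "u \<in> {?a..?b}" "Z u \<le> r" "Z ?b = Z u + w ?b - w u"
      by blast
    have "\<bar>w ?b - w u\<bar> \<le> e"
      using u(1) ab by (intro osc[rule_format]) auto
    then show ?thesis
      using u q_ge by linarith
  qed (use ab in auto)
  ultimately show ?case ..
qed

lemma lindley_tendsto_end:
  assumes S: "0 \<le> S"
  shows "(\<lambda>n. grid_queue S n n) \<longlonglongrightarrow> Z (s + S) - r"
proof (rule LIMSEQ_I)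
  fix e :: real assume "0 < e"
  have "\<forall>\<^sub>F n in sequentially. 0 < n \<and>
      (\<forall>u\<in>{s..s + S}. \<forall>v\<in>{s..s + S}. \<bar>u - v\<bar> \<le> S / real n \<longrightarrow> \<bar>w u - w v\<bar> \<le> e / 2)"
    using \<open>0 < e\<close> by (intro fine_grid continuous_on_subset[OF cont_w]) auto
  then have "\<forall>\<^sub>F n in sequentially. norm (grid_queue S n n - (Z (s + S) - r)) < e"
  proof eventually_elim
    case (elim n)
    then show ?case
      using lindley_approx[OF S, of n "e / 2" n] \<open>0 < e\<close> by (simp add: grid_end)
  qed
  then show "\<exists>no. \<forall>n\<ge>no. norm (grid_queue S n n - (Z (s + S) - r)) < e"
    by (simp add: eventually_sequentially)
qed

lemma lindley_mean_tendsto: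
  assumes S: "0 < S"
  shows "(\<lambda>n. (\<Sum>j<n. grid_queue S n (Suc j)) / real n)
    \<longlonglongrightarrow> 1 / S * (LBINT t:{s..<s + S}. Z t - r)"
proof -
  let ?f = "\<lambda>t. Z t - r"
  have cont: "continuous_on {s..s + S} ?f"
    by (intro continuous_intros continuous_on_subset[OF cont_Z]) auto
  have "(\<lambda>n. (\<Sum>j<n. grid_queue S n (Suc j)) / real n
      - (\<Sum>j<n. ?f (grid s S n (Suc j))) / real n) \<longlonglongrightarrow> 0"
  proof (rule LIMSEQ_I)
    fix e :: real assume "0 < e"
    have "\<forall>\<^sub>F n in sequentially. 0 < n \<and>
        (\<forall>u\<in>{s..s + S}. \<forall>v\<in>{s..s + S}. \<bar>u - v\<bar> \<le> S / real n \<longrightarrow> \<bar>w u - w v\<bar> \<le> e / 2)"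
      using \<open>0 < e\<close> by (intro fine_grid continuous_on_subset[OF cont_w]) auto
    then have "\<forall>\<^sub>F n in sequentially. norm ((\<Sum>j<n. grid_queue S n (Suc j)) / real n
      - (\<Sum>j<n. ?f (grid s S n (Suc j))) / real n - 0) < e"
    proof eventually_elim
      case (elim n)
      then have n: "0 < n" by simp
      have "\<bar>\<Sum>j<n. grid_queue S n (Suc j) - ?f (grid s S n (Suc j))\<bar>
        \<le> (\<Sum>j<n. \<bar>grid_queue S n (Suc j) - ?f (grid s S n (Suc j))\<bar>)"
        by (rule sum_abs)
      also have "\<dots> \<le> (\<Sum>j<n. e / 2)"
      proof (rule sum_mono)
        fix j assume "j \<in> {..<n}"
        then show "\<bar>grid_queue S n (Suc j) - ?f (grid s S n (Suc j))\<bar> \<le> e / 2"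
          using lindley_approx[of S n "e / 2" "Suc j"] elim S by auto
      qed
      also have "\<dots> < real n * e"
        using \<open>0 < e\<close> n by simp
      finally show ?case
        using n by (simp add: sum_subtractf sum.distrib diff_divide_distrib[symmetric] field_simps)
    qed
    then show "\<exists>no. \<forall>n\<ge>no. norm ((\<Sum>j<n. grid_queue S n (Suc j)) / real n
      - (\<Sum>j<n. ?f (grid s S n (Suc j))) / real n - 0) < e"
      by (simp add: eventually_sequentially)
  qed
  from tendsto_add[OF this riemann_sum_tendsto[OF cont S]] show ?thesis
    by simp
qed

end


section \<open>Existence of reflected paths\<close>

text \<open>The running maximum of a continuous function, characterised by the properties needed for reflection:
it is attained, so it grows only where the function itself is at its running maximum.\<close>

lemma running_maximum:
  fixes f :: "real \<Rightarrow> real"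
  assumes cont: "continuous_on {0..} f"
  obtains L where "continuous_on {0..} L" "mono_on {0..} L"
    "\<And>t. 0 \<le> t \<Longrightarrow> f t \<le> L t"
    "\<And>t. 0 \<le> t \<Longrightarrow> \<exists>u\<in>{0..t}. L t = f u"
proof -
  have "\<exists>u\<in>{0..t}. \<forall>v\<in>{0..t}. f v \<le> f u" if "0 \<le> t" for t
    using that by (intro continuous_attains_sup continuous_on_subset[OF cont]) auto
  then obtain m where m: "\<And>t. 0 \<le> t \<Longrightarrow> m t \<in> {0..t}"
    "\<And>t v. 0 \<le> t \<Longrightarrow> v \<in> {0..t} \<Longrightarrow> f v \<le> f (m t)"
    by metis
  define L where "L t = f (m t)" for t
  have L_ge: "f v \<le> L t" if "0 \<le> v" "v \<le> t" for v t
    using m(2)[of t v] that by (simp add: L_def)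
  have mono: "mono_on {0..} L"
    unfolding L_def by (intro mono_onI m(2)) (use m(1) in force)+
  have "continuous_on {0..} L"
    unfolding continuous_on_iff
  proof (intro ballI allI impI)
    fix t e :: real assume t: "t \<in> {0..}" and e: "0 < e"
    then obtain d where d: "0 < d" "\<And>u. 0 \<le> u \<Longrightarrow> \<bar>u - t\<bar> < d \<Longrightarrow> \<bar>f u - f t\<bar> < e / 3"
      using cont unfolding continuous_on_iff dist_real_def
      by (metis atLeast_iff divide_pos_pos zero_less_numeral)
    \<comment> \<open>Whatever \<open>L\<close> gains between \<open>p\<close> and \<open>q\<close> is a value of \<open>f\<close> near \<open>f t\<close>.\<close>
    have jump: "\<bar>L q - L p\<bar> < e" if pq: "0 \<le> p" "p \<le> q" and near: "\<bar>p - t\<bar> < d" "\<bar>q - t\<bar> < d" for p q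
    proof -
      have "L p \<le> L q"
        using pq by (intro mono_onD[OF mono]) auto
      moreover have "L q < L p + e"
      proof (cases "m q \<le> p")
        case True
        then have "L q \<le> L p"
          using L_ge[of "m q" p] m(1)[of q] pq by (simp add: L_def)
        then show ?thesis using e by simp
      next
        case False
        then have "\<bar>f (m q) - f t\<bar> < e / 3" "\<bar>f p - f t\<bar> < e / 3"
          using m(1)[of q] pq near by - (rule d(2); simp; linarith)+
        then show ?thesis
          using L_ge[of p p] pq e unfolding L_def[of q] by linarith
      qed
      ultimately show ?thesis by simp
    qed
    show "\<exists>d>0. \<forall>x'\<in>{0..}. dist x' t < d \<longrightarrow> dist (L x') (L t) < e"
    proof (intro exI[of _ d] conjI ballI impI)
      fix x' assume "x' \<in> {0..}" "dist x' t < d"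
      then show "dist (L x') (L t) < e"
        using jump[of x' t] jump[of t x'] t d(1)
        by (cases "x' \<le> t") (auto simp: dist_real_def abs_minus_commute)
    qed (rule d(1))
  qed
  then show thesis
    using mono L_ge m(1) by (intro that[of L]) (auto simp: L_def)
qed

text \<open>The Skorokhod construction: the pushing term is the running maximum of \<open>max 0 (r - y - w)\<close>. It grows
only when this maximum is attained anew, and there the resulting path sits on the barrier. Hence
it is constant on every interval on which the path stays above the barrier, and countably many such
intervals with rational endpoints cover the open set of all times above the barrier.\<close>

lemma reflected_path_exists:
  fixes w :: "real \<Rightarrow> real"
  assumes cont: "continuous_on {0..} w" and w0: "w 0 = 0" and "r \<le> y"
  shows "\<exists>Z Y. reflected_path 0 w y r Z Y"
proof -
  have "continuous_on {0..} (\<lambda>t. max 0 (r - y - w t))"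
    by (intro continuous_intros cont)
  then obtain L where cont_L: "continuous_on {0..} L" and mono_L: "mono_on {0..} L"
    and L_ge: "\<And>t. 0 \<le> t \<Longrightarrow> max 0 (r - y - w t) \<le> L t"
    and L_eq: "\<And>t. 0 \<le> t \<Longrightarrow> \<exists>u\<in>{0..t}. L t = max 0 (r - y - w u)"
    by (rule running_maximum) blast
  define Z where "Z t = y + w t + L t" for t
  have cont_Z: "continuous_on {0..} Z"
    unfolding Z_def by (intro continuous_intros cont cont_L)
  let ?\<mu> = "interval_measure (\<lambda>u. L (max 0 u))"
  \<comment> \<open>Otherwise the maximum is attained anew at some \<open>u\<close> in between, where the path is at \<open>r\<close>.\<close>
  have push_constant: "L (max 0 q) = L (max 0 p)"
    if "p \<le> q" and off: "\<And>u. p \<le> u \<Longrightarrow> u \<le> q \<Longrightarrow> r < Z (max 0 u)" for p q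
  proof (rule ccontr)
    assume neq: "L (max 0 q) \<noteq> L (max 0 p)"
    have "L (max 0 p) \<le> L (max 0 q)"
      using \<open>p \<le> q\<close> by (intro mono_onD[OF mono_L]) auto
    with neq have less: "L (max 0 p) < L (max 0 q)" by simp
    obtain u where u: "0 \<le> u" "u \<le> max 0 q" "L (max 0 q) = max 0 (r - y - w u)"
      using L_eq[of "max 0 q"] by auto
    have pos: "0 \<le> L (max 0 p)"
      using L_ge[of "max 0 p"] by simp
    have "max 0 p < u"
    proof (rule ccontr)
      assume "\<not> max 0 p < u"
      then have "L u \<le> L (max 0 p)"
        using u by (intro mono_onD[OF mono_L]) auto
      then show False
        using L_ge[OF u(1)] u(3) less by linarith
    qed
    then have "r < Z u"
      using off[of u] u by auto
    moreover have "L u \<le> L (max 0 q)"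
      using u by (intro mono_onD[OF mono_L]) auto
    ultimately show False
      using u less pos by (simp add: Z_def)
  qed
  have null: "{u. r < Z (max 0 u)} \<in> null_sets ?\<mu>"
  proof (rule null_sets_subset)
    let ?I = "{(p, q) \<in> \<rat> \<times> \<rat>. p \<le> q \<and> (\<forall>u. p \<le> u \<and> u \<le> q \<longrightarrow> r < Z (max 0 u))}"
    have "countable ?I"
      by (rule countable_subset[of _ "\<rat> \<times> \<rat>"]) (auto intro: countable_rat)
    then show "(\<Union>(p, q)\<in>?I. {p<..q}) \<in> null_sets ?\<mu>"
    proof (rule null_sets_UN', safe)
      fix p q :: real
      assume "p \<le> q" "\<forall>u. p \<le> u \<and> u \<le> q \<longrightarrow> r < Z (max 0 u)"
      then have "L (max 0 q) = L (max 0 p)"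
        by (intro push_constant) auto
      then show "{p<..q} \<in> null_sets ?\<mu>"
        using \<open>p \<le> q\<close> by (simp add: null_sets_def emeasure_pushing[OF cont_L mono_L])
    qed
    have cont': "continuous_on UNIV (\<lambda>u. Z (max 0 u))"
      by (intro continuous_on_compose2[OF cont_Z] continuous_intros) auto
    then have "open {u. r < Z (max 0 u)}"
      by (intro open_Collect_less continuous_intros)
    then show "{u. r < Z (max 0 u)} \<in> sets ?\<mu>"
      by simp
    show "{u. r < Z (max 0 u)} \<subseteq> (\<Union>(p, q)\<in>?I. {p<..q})"
    proof
      fix u assume "u \<in> {u. r < Z (max 0 u)}"
      with \<open>open {u. r < Z (max 0 u)}\<close> obtain e where e: "0 < e"
        "\<And>v. \<bar>v - u\<bar> < e \<Longrightarrow> r < Z (max 0 v)"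
        unfolding open_dist dist_real_def by (metis mem_Collect_eq)
      obtain p q where "p \<in> \<rat>" "u - e < p" "p < u" "q \<in> \<rat>" "u < q" "q < u + e"
        using Rats_dense_in_real[of "u - e" u] Rats_dense_in_real[of u "u + e"] e(1) by auto
      moreover have "r < Z (max 0 v)" if "p \<le> v" "v \<le> q" for v
        using that calculation by (intro e(2)) linarith
      ultimately have "(p, q) \<in> ?I" "u \<in> {p<..q}" by auto
      then show "u \<in> (\<Union>(p, q)\<in>?I. {p<..q})" by blast
    qed
  qed
  have "reflected_path 0 w y r Z L"
  proof
    show "L 0 = 0"
      using L_eq[of 0] w0 \<open>r \<le> y\<close> by simp
    show "r \<le> Z t" if "0 \<le> t" for t
      using L_ge[OF that] by (simp add: Z_def)
    show "(\<integral>\<^sup>+ u\<in>{0..t}. indicator {u. r < Z u} u \<partial>?\<mu>) = 0" if "0 \<le> t" for t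
    proof -
      have "AE u in ?\<mu>. u \<notin> {u. r < Z (max 0 u)}"
        by (rule AE_not_in[OF null])
      then have "(\<integral>\<^sup>+ u\<in>{0..t}. indicator {u. r < Z u} u \<partial>?\<mu>) = (\<integral>\<^sup>+ u. 0 \<partial>?\<mu>)"
        by (intro nn_integral_cong_AE) (auto simp: indicator_def elim!: eventually_mono)
      then show ?thesis by simp
    qed
  qed (use assms cont_Z cont_L mono_L in \<open>auto simp: Z_def\<close>)
  then show ?thesis by blast
qed

section \<open>Markov chains driven by Brownian increments\<close>

abbreviation gaussian :: "real \<Rightarrow> real measure" where
  "gaussian v \<equiv> density lborel (normal_density 0 (sqrt v))"

lemma sigma_finite_gaussian: "0 < v \<Longrightarrow> sigma_finite_measure (gaussian v)"
  by (intro prob_space_imp_sigma_finite prob_space_normal_density) simp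

text \<open>The transition operator of the Markov chain that moves from \<open>p\<close> to \<open>f (p, x)\<close>, where \<open>x\<close> is a fresh
centred Gaussian variable with variance \<open>v\<close>.\<close>

definition transition :: "('b \<times> real \<Rightarrow> 'b) \<Rightarrow> real \<Rightarrow> ('b \<Rightarrow> ennreal) \<Rightarrow> 'b \<Rightarrow> ennreal" where
  "transition f v \<phi> p = (\<integral>\<^sup>+ x. \<phi> (f (p, x)) \<partial>gaussian v)"

lemma transition_measurable:
  assumes v: "0 < v" and f: "f \<in> N \<Otimes>\<^sub>M borel \<rightarrow>\<^sub>M N" and \<phi>: "\<phi> \<in> borel_measurable N"
  shows "transition f v \<phi> \<in> borel_measurable N"
proof -
  interpret sigma_finite_measure "gaussian v" by (rule sigma_finite_gaussian[OF v])
  have "f \<in> N \<Otimes>\<^sub>M gaussian v \<rightarrow>\<^sub>M N"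
    using f by (subst measurable_cong_sets[OF sets_pair_measure_cong[OF refl, of _ borel] refl]) simp_all
  then have "(\<lambda>(p, x). \<phi> (f (p, x))) \<in> borel_measurable (N \<Otimes>\<^sub>M gaussian v)"
    using \<phi> by measurable
  then show ?thesis
    unfolding transition_def[abs_def] by (intro borel_measurable_nn_integral)
qed

lemma transition_pow_measurable:
  assumes "0 < v" "f \<in> N \<Otimes>\<^sub>M borel \<rightarrow>\<^sub>M N" "\<phi> \<in> borel_measurable N"
  shows "(transition f v ^^ n) \<phi> \<in> borel_measurable N"
  using assms by (induction n) (auto intro: transition_measurable)

text \<open>Completing the square turns the exponentially weighted centred density into a multiple of the density
with mean \<open>c * v\<close>.\<close>

lemma gaussian_exp_moment:
  assumes "0 < v"
  shows "(\<integral>\<^sup>+ x. ennreal (exp (c * x)) \<partial>gaussian v) = ennreal (exp (c\<^sup>2 * v / 2))"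
proof -
  have sq: "- x\<^sup>2 / (2 * v) + c * x = - (x - c * v)\<^sup>2 / (2 * v) + c\<^sup>2 * v / 2" for x
    using assms by (simp add: field_simps power2_eq_square)
  have eq: "normal_density 0 (sqrt v) x * exp (c * x)
    = exp (c\<^sup>2 * v / 2) * normal_density (c * v) (sqrt v) x" for x
  proof -
    have "exp (- x\<^sup>2 / (2 * v)) * exp (c * x) = exp (- (x - c * v)\<^sup>2 / (2 * v)) * exp (c\<^sup>2 * v / 2)"
      unfolding exp_add[symmetric] sq ..
    then show ?thesis
      using assms by (simp add: normal_density_def)
  qed
  interpret prob_space "density lborel (normal_density (c * v) (sqrt v))"
    using assms by (intro prob_space_normal_density) simp
  have one: "(\<integral>\<^sup>+ x. ennreal (normal_density (c * v) (sqrt v) x) \<partial>lborel) = 1"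
    using emeasure_space_1 by (simp add: emeasure_density)
  have "(\<integral>\<^sup>+ x. ennreal (exp (c * x)) \<partial>gaussian v)
    = (\<integral>\<^sup>+ x. ennreal (exp (c\<^sup>2 * v / 2)) * ennreal (normal_density (c * v) (sqrt v) x) \<partial>lborel)"
    by (subst nn_integral_density) (simp_all add: ennreal_mult'[symmetric] eq)
  also have "\<dots> = ennreal (exp (c\<^sup>2 * v / 2))"
    by (subst nn_integral_cmult) (simp_all add: one)
  finally show ?thesis .
qed

locale brownian =
  fixes M :: "'a measure" and F :: "real \<Rightarrow> 'a measure" and B :: "real \<Rightarrow> 'a \<Rightarrow> real"
  assumes filtered: "filtered_prob_space M F" and BM: "standard_BM M F B"

sublocale brownian \<subseteq> prob_space M
  using filtered by (simp add: filtered_prob_space_def)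

context brownian
begin

lemma space_F: "space (F t) = space M"
  using filtered filtration.space_F unfolding filtered_prob_space_def by metis

lemma F_mono: "s \<le> t \<Longrightarrow> sets (F s) \<subseteq> sets (F t)"
  using filtered filtration.sets_F_mono unfolding filtered_prob_space_def by metis

lemma F_le: "0 \<le> t \<Longrightarrow> sets (F t) \<subseteq> sets M"
  using filtered unfolding filtered_prob_space_def subalgebra_def by auto

lemma measurable_F_mono: "X \<in> F s \<rightarrow>\<^sub>M N \<Longrightarrow> s \<le> t \<Longrightarrow> X \<in> F t \<rightarrow>\<^sub>M N"
  using F_mono[of s t] by (intro measurable_mono[THEN subsetD, of N N "F s" "F t"]) (simp_all add: space_F)

lemma measurable_F_M: "X \<in> F s \<rightarrow>\<^sub>M N \<Longrightarrow> 0 \<le> s \<Longrightarrow> X \<in> M \<rightarrow>\<^sub>M N"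
  using F_le[of s] by (intro measurable_mono[THEN subsetD, of N N "F s" M]) (simp_all add: space_F)

lemma B_adapted: "0 \<le> t \<Longrightarrow> t \<le> u \<Longrightarrow> B t \<in> borel_measurable (F u)"
  using BM measurable_F_mono[of "B t" t borel u] by (auto simp: standard_BM_def)

lemma B_measurable: "0 \<le> t \<Longrightarrow> B t \<in> borel_measurable M"
  by (rule measurable_F_M[of _ t], rule B_adapted) auto

lemma B_continuous: "\<omega> \<in> space M \<Longrightarrow> continuous_on {0..} (\<lambda>t. B t \<omega>)"
  using BM by (auto simp: standard_BM_def)

text \<open>An increment after time \<open>s\<close> is independent of \<open>F s\<close>, so its joint law with an \<open>F s\<close>-measurable
\<open>U\<close> is the product of the laws, and the two iterated integrals are those of Tonelli's theorem. This is
the only place where the independence of the increments enters.\<close>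

lemma
  assumes st: "0 \<le> s" "s < t" and U: "U \<in> F s \<rightarrow>\<^sub>M N"
    and \<Phi>: "\<Phi> \<in> borel_measurable (N \<Otimes>\<^sub>M borel)"
  shows nn_integral_independent_increment:
    "(\<integral>\<^sup>+ \<omega>. \<Phi> (U \<omega>, B t \<omega> - B s \<omega>) \<partial>M)
      = (\<integral>\<^sup>+ \<omega>. (\<integral>\<^sup>+ x. \<Phi> (U \<omega>, x) \<partial>gaussian (t - s)) \<partial>M)"
    and nn_integral_independent_increment':
    "(\<integral>\<^sup>+ \<omega>. \<Phi> (U \<omega>, B t \<omega> - B s \<omega>) \<partial>M)
      = (\<integral>\<^sup>+ x. (\<integral>\<^sup>+ \<omega>. \<Phi> (U \<omega>, x) \<partial>M) \<partial>gaussian (t - s))"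
proof -
  let ?D = "\<lambda>\<omega>. B t \<omega> - B s \<omega>"
  have UM: "U \<in> M \<rightarrow>\<^sub>M N"
    using U st by (intro measurable_F_M)
  have DM: "?D \<in> borel_measurable M"
    using st by (intro borel_measurable_diff B_measurable) auto
  have dist: "distr M lborel ?D = gaussian (t - s)"
    and ind: "indep_set (sets (F s)) (sets (vimage_algebra (space M) ?D borel))"
    using BM st by (auto simp: standard_BM_def distributed_def)
  have dist': "distr M borel ?D = gaussian (t - s)"
    by (rule trans[OF distr_cong dist]) auto
  interpret DU: prob_space "distr M N U" using UM by (rule prob_space_distr)
  interpret G: sigma_finite_measure "gaussian (t - s)" using st by (intro sigma_finite_gaussian) simp
  have joint: "distr M N U \<Otimes>\<^sub>M gaussian (t - s) = distr M (N \<Otimes>\<^sub>M borel) (\<lambda>\<omega>. (U \<omega>, ?D \<omega>))"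
  proof (rule pair_measure_eqI)
    show "sets (distr M N U \<Otimes>\<^sub>M gaussian (t - s)) = sets (distr M (N \<Otimes>\<^sub>M borel) (\<lambda>\<omega>. (U \<omega>, ?D \<omega>)))"
      by (simp cong: sets_pair_measure_cong)
    fix A C assume A: "A \<in> sets (distr M N U)" and C: "C \<in> sets (gaussian (t - s))"
    have "U -` A \<inter> space M \<in> sets (F s)"
      using measurable_sets[OF U, of A] A by (simp add: space_F)
    moreover have "?D -` C \<inter> space M \<in> sets (vimage_algebra (space M) ?D borel)"
      using C by (intro in_vimage_algebra) simp
    ultimately have "prob ((U -` A \<inter> space M) \<inter> (?D -` C \<inter> space M))
      = prob (U -` A \<inter> space M) * prob (?D -` C \<inter> space M)"
      by (rule indep_setD[OF ind])
    moreover have "(U -` A \<inter> space M) \<inter> (?D -` C \<inter> space M)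
      = (\<lambda>\<omega>. (U \<omega>, ?D \<omega>)) -` (A \<times> C) \<inter> space M"
      by auto
    ultimately show "emeasure (distr M N U) A * emeasure (gaussian (t - s)) C
      = emeasure (distr M (N \<Otimes>\<^sub>M borel) (\<lambda>\<omega>. (U \<omega>, ?D \<omega>))) (A \<times> C)"
      unfolding dist'[symmetric] using A C UM DM
      by (simp add: emeasure_distr emeasure_eq_measure ennreal_mult)
  qed unfold_locales
  interpret pair_sigma_finite "distr M N U" "gaussian (t - s)" ..
  have \<Phi>': "\<Phi> \<in> borel_measurable (distr M N U \<Otimes>\<^sub>M gaussian (t - s))"
    using \<Phi> by (simp cong: measurable_cong_sets sets_pair_measure_cong)
  have pair: "(\<integral>\<^sup>+ \<omega>. \<Phi> (U \<omega>, ?D \<omega>) \<partial>M) = integral\<^sup>N (distr M N U \<Otimes>\<^sub>M gaussian (t - s)) \<Phi>"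
    unfolding joint using UM DM \<Phi> by (subst nn_integral_distr) auto
  show "(\<integral>\<^sup>+ \<omega>. \<Phi> (U \<omega>, ?D \<omega>) \<partial>M)
      = (\<integral>\<^sup>+ \<omega>. (\<integral>\<^sup>+ x. \<Phi> (U \<omega>, x) \<partial>gaussian (t - s)) \<partial>M)"
    unfolding pair G.nn_integral_fst[OF \<Phi>', symmetric]
    using UM G.borel_measurable_nn_integral_fst[OF \<Phi>']
    by (subst nn_integral_distr) auto
  have "integral\<^sup>N (distr M N U \<Otimes>\<^sub>M gaussian (t - s)) \<Phi>
    = (\<integral>\<^sup>+ x. (\<integral>\<^sup>+ p. \<Phi> (p, x) \<partial>distr M N U) \<partial>gaussian (t - s))"
    by (rule nn_integral_snd[OF \<Phi>', symmetric])
  also have "\<dots> = (\<integral>\<^sup>+ x. (\<integral>\<^sup>+ \<omega>. \<Phi> (U \<omega>, x) \<partial>M) \<partial>gaussian (t - s))"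
    using UM \<Phi> by (intro nn_integral_cong, subst nn_integral_distr) auto
  finally show "(\<integral>\<^sup>+ \<omega>. \<Phi> (U \<omega>, ?D \<omega>) \<partial>M)
      = (\<integral>\<^sup>+ x. (\<integral>\<^sup>+ \<omega>. \<Phi> (U \<omega>, x) \<partial>M) \<partial>gaussian (t - s))"
    unfolding pair .
qed

text \<open>The operator \<open>transition f (S / n)\<close> depends neither on the starting time \<open>s\<close> nor on the law
of \<open>V 0\<close>. This is what later transports an estimate from a deterministic start at time \<open>0\<close> to a random
start at time \<open>s\<close>, without any statement about laws on path space.\<close>

lemma
  fixes V :: "nat \<Rightarrow> 'a \<Rightarrow> 'b"
  assumes s: "0 \<le> s" and S: "0 < S" and n: "0 < n"
    and f: "f \<in> N \<Otimes>\<^sub>M borel \<rightarrow>\<^sub>M N" and V0: "V 0 \<in> F s \<rightarrow>\<^sub>M N"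
    and step: "\<And>j \<omega>. \<omega> \<in> space M \<Longrightarrow>
      V (Suc j) \<omega> = f (V j \<omega>, B (grid s S n (Suc j)) \<omega> - B (grid s S n j) \<omega>)"
  shows chain_adapted: "V j \<in> F (grid s S n j) \<rightarrow>\<^sub>M N"
    and nn_integral_chain: "\<phi> \<in> borel_measurable N \<Longrightarrow>
      (\<integral>\<^sup>+ \<omega>. \<phi> (V j \<omega>) \<partial>M) = (\<integral>\<^sup>+ \<omega>. (transition f (S / real n) ^^ j) \<phi> (V 0 \<omega>) \<partial>M)"
proof -
  have g: "0 \<le> grid s S n j" "grid s S n j < grid s S n (Suc j)" for j
    using s S n by (auto simp: grid_def divide_strict_right_mono)
  show adapted: "V j \<in> F (grid s S n j) \<rightarrow>\<^sub>M N" for j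
  proof (induction j)
    case (Suc j)
    let ?F = "F (grid s S n (Suc j))"
    have [measurable]: "V j \<in> ?F \<rightarrow>\<^sub>M N"
      using Suc g(2)[of j] by (intro measurable_F_mono[where t = "grid s S n (Suc j)"]) auto
    have [measurable]: "B (grid s S n (Suc j)) \<in> borel_measurable ?F"
      "B (grid s S n j) \<in> borel_measurable ?F"
      using g[of j] g(1)[of "Suc j"] by (auto intro!: B_adapted)
    have "(\<lambda>\<omega>. f (V j \<omega>, B (grid s S n (Suc j)) \<omega> - B (grid s S n j) \<omega>)) \<in> ?F \<rightarrow>\<^sub>M N"
      using f by measurable
    then show ?case
      by (subst measurable_cong[where g = "\<lambda>\<omega>. f (V j \<omega>, B (grid s S n (Suc j)) \<omega> - B (grid s S n j) \<omega>)"])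
        (auto simp: space_F step)
  qed (simp add: V0)
  show "(\<integral>\<^sup>+ \<omega>. \<phi> (V j \<omega>) \<partial>M) = (\<integral>\<^sup>+ \<omega>. (transition f (S / real n) ^^ j) \<phi> (V 0 \<omega>) \<partial>M)"
    if "\<phi> \<in> borel_measurable N"
    using that
  proof (induction j arbitrary: \<phi>)
    case (Suc j)
    have "(\<integral>\<^sup>+ \<omega>. \<phi> (V (Suc j) \<omega>) \<partial>M)
      = (\<integral>\<^sup>+ \<omega>. (\<phi> \<circ> f) (V j \<omega>, B (grid s S n (Suc j)) \<omega> - B (grid s S n j) \<omega>) \<partial>M)"
      by (intro nn_integral_cong) (simp add: step)
    also have "\<dots> = (\<integral>\<^sup>+ \<omega>. transition f (S / real n) \<phi> (V j \<omega>) \<partial>M)"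
      using g[of j] adapted[of j] f Suc.prems
      by (subst nn_integral_independent_increment[where N = N])
        (auto simp: transition_def grid_Suc)
    also have "\<dots> = (\<integral>\<^sup>+ \<omega>. (transition f (S / real n) ^^ j) (transition f (S / real n) \<phi>) (V 0 \<omega>) \<partial>M)"
      by (intro Suc.IH transition_measurable f Suc.prems) (use S n in simp)
    finally show ?case
      by (simp add: funpow_swap1)
  qed simp
qed

end


section \<open>Reflected Brownian motion\<close>

lemma reflected_BM_path:
  assumes "reflected_BM F B th sg \<Omega> s y r Z Y" "\<omega> \<in> \<Omega>"
  shows "reflected_path s (\<lambda>t. th * (t - s) + sg * (B t \<omega> - B s \<omega>)) (y \<omega>) (r \<omega>)
    (\<lambda>t. Z t \<omega>) (\<lambda>t. Y t \<omega>)"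
proof -
  have P: "r \<omega> \<le> y \<omega>" "continuous_on {s..} (\<lambda>t. Z t \<omega>)" "continuous_on {s..} (\<lambda>t. Y t \<omega>)"
    "mono_on {s..} (\<lambda>t. Y t \<omega>)" "Y s \<omega> = 0"
    "\<And>t. s \<le> t \<Longrightarrow> Z t \<omega> = y \<omega> + th * (t - s) + sg * (B t \<omega> - B s \<omega>) + Y t \<omega>"
    "\<And>t. s \<le> t \<Longrightarrow> r \<omega> \<le> Z t \<omega>"
    "\<And>t. s \<le> t \<Longrightarrow> (\<integral>\<^sup>+ u\<in>{s..t}. indicator {u. r \<omega> < Z u \<omega>} u
      \<partial>interval_measure (\<lambda>u. Y (max s u) \<omega>)) = 0"
    using assms unfolding reflected_BM_def by blast+
  show ?thesis
  proof
    show "Z t \<omega> = y \<omega> + (th * (t - s) + sg * (B t \<omega> - B s \<omega>)) + Y t \<omega>" if "s \<le> t" for t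
      using P(6)[OF that] by simp
  qed (fact P)+
qed

text \<open>One step of Lindley's recursion together with the running sum of its values, so that the time
average becomes a function of the state of a Markov chain.\<close>

definition queue_step :: "real \<Rightarrow> real \<Rightarrow> (real \<times> real) \<times> real \<Rightarrow> real \<times> real" where
  "queue_step c sg = (\<lambda>(p, x). (max (fst p + (c + sg * x)) 0, snd p + max (fst p + (c + sg * x)) 0))"

lemma queue_step_measurable [measurable]:
  "queue_step c sg \<in> (borel \<Otimes>\<^sub>M borel) \<Otimes>\<^sub>M borel \<rightarrow>\<^sub>M borel \<Otimes>\<^sub>M borel"
  unfolding queue_step_def by measurable

text \<open>Layer-cake formula: \<open>X\<^sup>4\<close> is the integral of \<open>4 a\<^sup>3\<close> over \<open>[0, X]\<close>, and integrating \<open>4 a\<^sup>3 exp (- g a)\<close>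
gives the fourth moment of the exponential distribution.\<close>

lemma fourth_moment_of_exponential_tail:
  fixes X :: "'a \<Rightarrow> real"
  assumes "prob_space M" and X: "X \<in> borel_measurable M" and g: "0 < g"
    and nonneg: "\<And>\<omega>. \<omega> \<in> space M \<Longrightarrow> 0 \<le> X \<omega>"
    and tail: "\<And>a. 0 \<le> a \<Longrightarrow> emeasure M {\<omega> \<in> space M. a \<le> X \<omega>} \<le> ennreal (exp (- g * a))"
  shows "(\<integral>\<^sup>+ \<omega>. ennreal (X \<omega> ^ 4) \<partial>M) \<le> ennreal (fact 4 / g ^ 4)"
proof -
  interpret prob_space M by fact
  interpret pair_sigma_finite M lborel ..
  have [measurable]: "X \<in> borel_measurable M" by fact
  have power: "ennreal (X \<omega> ^ 4) = (\<integral>\<^sup>+ a. ennreal (4 * a ^ 3) * indicator {0..X \<omega>} a \<partial>lborel)"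
    if "\<omega> \<in> space M" for \<omega>
  proof -
    have "(\<integral>\<^sup>+ a. ennreal (4 * a ^ 3) * indicator {0..X \<omega>} a \<partial>lborel) = ennreal (X \<omega> ^ 4 - 0 ^ 4)"
      using nonneg[OF that]
      by (intro nn_integral_FTC_Icc) (auto intro!: derivative_eq_intros)
    then show ?thesis by simp
  qed
  have "(\<integral>\<^sup>+ \<omega>. ennreal (X \<omega> ^ 4) \<partial>M)
    = (\<integral>\<^sup>+ \<omega>. (\<integral>\<^sup>+ a. ennreal (4 * a ^ 3) * indicator {0..X \<omega>} a \<partial>lborel) \<partial>M)"
    by (intro nn_integral_cong power)
  also have "\<dots> = (\<integral>\<^sup>+ a. (\<integral>\<^sup>+ \<omega>. ennreal (4 * a ^ 3) * indicator {0..X \<omega>} a \<partial>M) \<partial>lborel)"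
  proof (rule Fubini'[symmetric])
    have "(\<lambda>(\<omega>, a). ennreal (4 * a ^ 3) * indicator {q. 0 \<le> snd q \<and> snd q \<le> X (fst q)} (\<omega>, a))
      \<in> borel_measurable (M \<Otimes>\<^sub>M lborel)"
      by measurable
    then show "(\<lambda>(\<omega>, a). ennreal (4 * a ^ 3) * indicator {0..X \<omega>} a) \<in> borel_measurable (M \<Otimes>\<^sub>M lborel)"
      by (simp add: indicator_def case_prod_unfold)
  qed
  also have "\<dots> \<le> (\<integral>\<^sup>+ a. ennreal (4 / g) * ennreal (erlang_density 0 g a * a ^ 3) \<partial>lborel)"
  proof (rule nn_integral_mono)
    fix a :: real
    have "(\<integral>\<^sup>+ \<omega>. ennreal (4 * a ^ 3) * indicator {0..X \<omega>} a \<partial>M)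
      = (\<integral>\<^sup>+ \<omega>. ennreal (4 * a ^ 3) * indicator {0..} a * indicator {\<omega> \<in> space M. a \<le> X \<omega>} \<omega> \<partial>M)"
      by (intro nn_integral_cong) (auto simp: indicator_def)
    also have "\<dots> = ennreal (4 * a ^ 3) * indicator {0..} a * emeasure M {\<omega> \<in> space M. a \<le> X \<omega>}"
      by (rule nn_integral_cmult_indicator) measurable
    also have "\<dots> \<le> ennreal (4 / g) * ennreal (erlang_density 0 g a * a ^ 3)"
    proof (cases "0 \<le> a")
      case True
      then have "ennreal (4 * a ^ 3) * indicator {0..} a * emeasure M {\<omega> \<in> space M. a \<le> X \<omega>}
        \<le> ennreal (4 * a ^ 3) * ennreal (exp (- g * a))"
        using tail[OF True] by (simp add: mult_left_mono)
      also have "\<dots> = ennreal (4 / g) * ennreal (erlang_density 0 g a * a ^ 3)"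
        using True g by (simp add: erlang_density_def ennreal_mult'[symmetric] field_simps)
      finally show ?thesis .
    qed simp
    finally show "(\<integral>\<^sup>+ \<omega>. ennreal (4 * a ^ 3) * indicator {0..X \<omega>} a \<partial>M)
      \<le> ennreal (4 / g) * ennreal (erlang_density 0 g a * a ^ 3)" .
  qed
  also have "\<dots> = ennreal (4 / g) * (\<integral>\<^sup>+ a. ennreal (erlang_density 0 g a * a ^ 3) \<partial>lborel)"
    by (subst nn_integral_cmult) auto
  also have "\<dots> = ennreal (fact 4 / g ^ 4)"
    using g by (subst nn_integral_erlang_ith_moment)
      (auto simp: ennreal_mult'[symmetric] fact_numeral power_numeral_reduce)
  finally show ?thesis .
qed

context brownian
begin

definition increment :: "real \<Rightarrow> real \<Rightarrow> real \<Rightarrow> real \<Rightarrow> nat \<Rightarrow> 'a \<Rightarrow> nat \<Rightarrow> real" where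
  "increment th sg s S n \<omega> j
    = th * (S / real n) + sg * (B (grid s S n (Suc j)) \<omega> - B (grid s S n j) \<omega>)"

definition queue_state ::
  "real \<Rightarrow> real \<Rightarrow> real \<Rightarrow> real \<Rightarrow> nat \<Rightarrow> real \<Rightarrow> 'a \<Rightarrow> nat \<Rightarrow> real \<times> real" where
  "queue_state th sg s S n z \<omega> j =
    (lindley z (increment th sg s S n \<omega>) j,
     \<Sum>i<j. lindley z (increment th sg s S n \<omega>) (Suc i))"

lemma queue_state_Suc:
  "queue_state th sg s S n z \<omega> (Suc j) = queue_step (th * (S / real n)) sg
    (queue_state th sg s S n z \<omega> j, B (grid s S n (Suc j)) \<omega> - B (grid s S n j) \<omega>)"
  by (simp add: queue_state_def queue_step_def increment_def)

lemma queue_state_0: "queue_state th sg s S n z \<omega> 0 = (z, 0)"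
  by (simp add: queue_state_def)

text \<open>Pathwise convergence of the discretisation. Expected costs of time averages and moments
of the reflected process are obtained by passing to this limit.\<close>

lemma
  assumes "reflected_BM F B th sg (space M) s y r Z Y" and \<omega>: "\<omega> \<in> space M"
  shows queue_state_tendsto_end: "0 \<le> S \<Longrightarrow>
      (\<lambda>n. fst (queue_state th sg s S n (y \<omega> - r \<omega>) \<omega> n)) \<longlonglongrightarrow> Z (s + S) \<omega> - r \<omega>"
    and queue_state_tendsto_mean: "0 < S \<Longrightarrow>
      (\<lambda>n. snd (queue_state th sg s S n (y \<omega> - r \<omega>) \<omega> n) / real n)
        \<longlonglongrightarrow> 1 / S * (LBINT t:{s..<s + S}. Z t \<omega> - r \<omega>)"
proof -
  interpret reflected_path s "\<lambda>t. th * (t - s) + sg * (B t \<omega> - B s \<omega>)" "y \<omega>" "r \<omega>"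
    "\<lambda>t. Z t \<omega>" "\<lambda>t. Y t \<omega>"
    using assms by (rule reflected_BM_path)
  have "grid_queue S n j = lindley (y \<omega> - r \<omega>) (increment th sg s S n \<omega>) j" for S n j
  proof -
    have "th * (grid s S n (Suc i) - s) + sg * (B (grid s S n (Suc i)) \<omega> - B s \<omega>)
      - (th * (grid s S n i - s) + sg * (B (grid s S n i) \<omega> - B s \<omega>))
      = increment th sg s S n \<omega> i" for i
      unfolding increment_def grid_Suc by (simp add: algebra_simps)
    then show ?thesis
      using w_start by (simp add: grid_queue_def)
  qed
  then show "0 \<le> S \<Longrightarrow>
      (\<lambda>n. fst (queue_state th sg s S n (y \<omega> - r \<omega>) \<omega> n)) \<longlonglongrightarrow> Z (s + S) \<omega> - r \<omega>"
    and "0 < S \<Longrightarrow>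
      (\<lambda>n. snd (queue_state th sg s S n (y \<omega> - r \<omega>) \<omega> n) / real n)
        \<longlonglongrightarrow> 1 / S * (LBINT t:{s..<s + S}. Z t \<omega> - r \<omega>)"
    using lindley_tendsto_end[of S] lindley_mean_tendsto[of S] by (simp_all add: queue_state_def)
qed

lemma
  assumes "0 \<le> s" "0 < S" "0 < n" and z: "z \<in> borel_measurable (F s)"
  shows queue_state_adapted:
      "(\<lambda>\<omega>. queue_state th sg s S n (z \<omega>) \<omega> j) \<in> F (grid s S n j) \<rightarrow>\<^sub>M borel \<Otimes>\<^sub>M borel"
    and nn_integral_queue_state: "\<phi> \<in> borel_measurable (borel \<Otimes>\<^sub>M borel) \<Longrightarrow>
      (\<integral>\<^sup>+ \<omega>. \<phi> (queue_state th sg s S n (z \<omega>) \<omega> j) \<partial>M)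
        = (\<integral>\<^sup>+ \<omega>. (transition (queue_step (th * (S / real n)) sg) (S / real n) ^^ j) \<phi> (z \<omega>, 0) \<partial>M)"
proof -
  have z0: "(\<lambda>\<omega>. queue_state th sg s S n (z \<omega>) \<omega> 0) \<in> F s \<rightarrow>\<^sub>M borel \<Otimes>\<^sub>M borel"
    using z by (simp add: queue_state_0)
  show "(\<lambda>\<omega>. queue_state th sg s S n (z \<omega>) \<omega> j) \<in> F (grid s S n j) \<rightarrow>\<^sub>M borel \<Otimes>\<^sub>M borel"
    by (rule chain_adapted[where V = "\<lambda>j \<omega>. queue_state th sg s S n (z \<omega>) \<omega> j"
        and f = "queue_step (th * (S / real n)) sg"])
      (use assms z0 in \<open>simp_all add: queue_state_Suc\<close>)
  show "(\<integral>\<^sup>+ \<omega>. \<phi> (queue_state th sg s S n (z \<omega>) \<omega> j) \<partial>M)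
    = (\<integral>\<^sup>+ \<omega>. (transition (queue_step (th * (S / real n)) sg) (S / real n) ^^ j) \<phi> (z \<omega>, 0) \<partial>M)"
    if "\<phi> \<in> borel_measurable (borel \<Otimes>\<^sub>M borel)"
    by (subst nn_integral_chain[where V = "\<lambda>j \<omega>. queue_state th sg s S n (z \<omega>) \<omega> j"
        and f = "queue_step (th * (S / real n)) sg" and N = "borel \<Otimes>\<^sub>M borel"])
      (use assms z0 that in \<open>simp_all add: queue_state_Suc queue_state_0\<close>)
qed

text \<open>The paths are chosen separately for each outcome. Whatever choice is made, the value at time \<open>t\<close> is
the limit of Lindley recursions on \<open>[0, t]\<close>, and these depend measurably on \<open>B\<close> up to time \<open>t\<close>.\<close>

lemma reflected_BM_exists:
  fixes r y th sg :: real
  assumes "r \<le> y"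
  shows "\<exists>Z Y. reflected_BM F B th sg (space M) 0 (\<lambda>_. y) (\<lambda>_. r) Z Y"
proof -
  let ?w = "\<lambda>\<omega> t. th * t + sg * (B t \<omega> - B 0 \<omega>)"
  have "\<forall>\<omega>\<in>space M. \<exists>Z Y. reflected_path 0 (?w \<omega>) y r Z Y"
    using assms by (intro ballI reflected_path_exists continuous_intros B_continuous) auto
  then obtain Z Y where path: "\<And>\<omega>. \<omega> \<in> space M \<Longrightarrow> reflected_path 0 (?w \<omega>) y r (Z \<omega>) (Y \<omega>)"
    by metis
  have Z_adapted: "(\<lambda>\<omega>. Z \<omega> t) \<in> borel_measurable (F t)" if "0 \<le> t" for t
  proof (cases "t = 0")
    case True
    have "Z \<omega> 0 = y" if "\<omega> \<in> space M" for \<omega>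
      using reflected_path.w_start[OF path[OF that]] by simp
    then have "(\<lambda>\<omega>. Z \<omega> 0) \<in> borel_measurable (F 0) \<longleftrightarrow> (\<lambda>_. y) \<in> borel_measurable (F 0)"
      by (intro measurable_cong) (simp add: space_F)
    then show ?thesis using True by simp
  next
    case False
    with that have t: "0 < t" by simp
    have "(\<lambda>\<omega>. Z \<omega> t - r) \<in> borel_measurable (F t)"
    proof (rule borel_measurable_LIMSEQ_real)
      fix \<omega> assume "\<omega> \<in> space (F t)"
      then have \<omega>: "\<omega> \<in> space M" by (simp add: space_F)
      interpret reflected_path 0 "?w \<omega>" y r "Z \<omega>" "Y \<omega>" by (rule path[OF \<omega>])
      have "grid_queue t n j = lindley (y - r) (increment th sg 0 t n \<omega>) j" for n j
      proof -
        have "?w \<omega> (grid 0 t n (Suc i)) - ?w \<omega> (grid 0 t n i) = increment th sg 0 t n \<omega> i" for i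
          unfolding increment_def grid_Suc by (simp add: algebra_simps)
        then show ?thesis
          using w_start by (simp add: grid_queue_def)
      qed
      then have "(\<lambda>n. fst (queue_state th sg 0 t n (y - r) \<omega> n)) \<longlonglongrightarrow> Z \<omega> t - r"
        using lindley_tendsto_end[of t] t by (simp add: queue_state_def)
      then show "(\<lambda>m. fst (queue_state th sg 0 t (Suc m) (y - r) \<omega> (Suc m))) \<longlonglongrightarrow> Z \<omega> t - r"
        by (rule LIMSEQ_Suc)
    next
      fix m
      have "(\<lambda>\<omega>. queue_state th sg 0 t (Suc m) (y - r) \<omega> (Suc m)) \<in> F t \<rightarrow>\<^sub>M borel \<Otimes>\<^sub>M borel"
        using queue_state_adapted[of 0 t "Suc m" "\<lambda>_. y - r" th sg "Suc m"] t
        by (simp add: grid_end)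
      then show "(\<lambda>\<omega>. fst (queue_state th sg 0 t (Suc m) (y - r) \<omega> (Suc m))) \<in> borel_measurable (F t)"
        by measurable
    qed
    then have "(\<lambda>\<omega>. (Z \<omega> t - r) + r) \<in> borel_measurable (F t)"
      by measurable
    then show ?thesis by simp
  qed
  have Y_adapted: "(\<lambda>\<omega>. Y \<omega> t) \<in> borel_measurable (F t)" if "0 \<le> t" for t
  proof -
    have [measurable]: "B t \<in> borel_measurable (F t)" "B 0 \<in> borel_measurable (F t)"
      "(\<lambda>\<omega>. Z \<omega> t) \<in> borel_measurable (F t)"
      using that by (auto intro: B_adapted Z_adapted)
    have "Y \<omega> t = Z \<omega> t - y - ?w \<omega> t" if "\<omega> \<in> space M" for \<omega>
      using reflected_path.decomp[OF path[OF that] \<open>0 \<le> t\<close>] by simp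
    then have "(\<lambda>\<omega>. Y \<omega> t) \<in> borel_measurable (F t)
      \<longleftrightarrow> (\<lambda>\<omega>. Z \<omega> t - y - ?w \<omega> t) \<in> borel_measurable (F t)"
      by (intro measurable_cong) (simp add: space_F)
    then show ?thesis by simp
  qed
  have "reflected_BM F B th sg (space M) 0 (\<lambda>_. y) (\<lambda>_. r) (\<lambda>t \<omega>. Z \<omega> t) (\<lambda>t \<omega>. Y \<omega> t)"
    unfolding reflected_BM_def
  proof (intro conjI ballI allI impI)
    fix \<omega> t assume \<omega>: "\<omega> \<in> space M" and t: "0 \<le> (t::real)"
    show "Z \<omega> t = y + th * (t - 0) + sg * (B t \<omega> - B 0 \<omega>) + Y \<omega> t"
      using reflected_path.decomp[OF path[OF \<omega>] t] by simp
    show "r \<le> Z \<omega> t"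
      by (rule reflected_path.ge_barrier[OF path[OF \<omega>] t])
    show "(\<integral>\<^sup>+ u\<in>{0..t}. indicator {u. r < Z \<omega> u} u \<partial>interval_measure (\<lambda>u. Y \<omega> (max 0 u))) = 0"
      by (rule reflected_path.complementarity[OF path[OF \<omega>] t])
  next
    fix \<omega> assume \<omega>: "\<omega> \<in> space M"
    interpret reflected_path 0 "?w \<omega>" y r "Z \<omega>" "Y \<omega>" by (rule path[OF \<omega>])
    show "r \<le> y" "continuous_on {0..} (Z \<omega>)" "continuous_on {0..} (Y \<omega>)"
      "mono_on {0..} (Y \<omega>)" "Y \<omega> 0 = 0"
      by (fact start_ge cont_Z cont_Y mono_Y Y_start)+
  qed (simp_all add: Z_adapted Y_adapted)
  then show ?thesis by blast
qed

text \<open>The expected cost \<open>g\<close> of the average of the \<open>n\<close> discretised values after a start at height \<open>z\<close> above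
the barrier, written with the transition operator: it is a function of \<open>z\<close> alone, the same for every
starting time.\<close>

definition queue_mean_cost ::
  "real \<Rightarrow> real \<Rightarrow> real \<Rightarrow> (real \<Rightarrow> real) \<Rightarrow> nat \<Rightarrow> real \<Rightarrow> ennreal" where
  "queue_mean_cost th sg S g n z =
    (transition (queue_step (th * (S / real n)) sg) (S / real n) ^^ n)
      (\<lambda>p. ennreal (g (snd p / real n))) (z, 0)"

lemma nn_integral_queue_mean:
  assumes "0 \<le> s" "0 < S" "0 < n" "z \<in> borel_measurable (F s)"
    and [measurable]: "g \<in> borel_measurable borel"
  shows "(\<integral>\<^sup>+ \<omega>. ennreal (g (snd (queue_state th sg s S n (z \<omega>) \<omega> n) / real n)) \<partial>M)
    = (\<integral>\<^sup>+ \<omega>. queue_mean_cost th sg S g n (z \<omega>) \<partial>M)"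
  unfolding queue_mean_cost_def
  using nn_integral_queue_state[OF assms(1-4), of "\<lambda>p. ennreal (g (snd p / real n))" th sg n]
  by simp

lemma queue_mean_cost_eq:
  assumes "0 < S" "0 < n" "g \<in> borel_measurable borel"
  shows "queue_mean_cost th sg S g n z
    = (\<integral>\<^sup>+ \<omega>. ennreal (g (snd (queue_state th sg 0 S n z \<omega> n) / real n)) \<partial>M)"
  using nn_integral_queue_mean[of 0 S n "\<lambda>_. z" g th sg] assms
  by (simp add: emeasure_space_1)

lemma queue_mean_cost_measurable:
  assumes "0 < S" "0 < n" and [measurable]: "g \<in> borel_measurable borel"
  shows "queue_mean_cost th sg S g n \<in> borel_measurable borel"
proof -
  have "(transition (queue_step (th * (S / real n)) sg) (S / real n) ^^ n)
      (\<lambda>p. ennreal (g (snd p / real n))) \<in> borel_measurable (borel \<Otimes>\<^sub>M borel)"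
    using assms by (intro transition_pow_measurable) auto
  then show ?thesis
    unfolding queue_mean_cost_def[abs_def] by measurable
qed

lemma time_average_measurable:
  assumes RBM: "reflected_BM F B th sg (space M) s y r Z Y" and "0 \<le> s" "0 < S"
  shows "(\<lambda>\<omega>. 1 / S * (LBINT t:{s..<s + S}. Z t \<omega> - r \<omega>)) \<in> borel_measurable M"
proof (rule borel_measurable_LIMSEQ_real)
  have [measurable]: "y \<in> borel_measurable (F s)" "r \<in> borel_measurable (F s)"
    using RBM by (auto simp: reflected_BM_def)
  show "(\<lambda>m. snd (queue_state th sg s S (Suc m) (y \<omega> - r \<omega>) \<omega> (Suc m)) / real (Suc m))
    \<longlonglongrightarrow> 1 / S * (LBINT t:{s..<s + S}. Z t \<omega> - r \<omega>)" if "\<omega> \<in> space M" for \<omega>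
    using queue_state_tendsto_mean[OF RBM that \<open>0 < S\<close>] by (rule LIMSEQ_Suc)
  show "(\<lambda>\<omega>. snd (queue_state th sg s S (Suc m) (y \<omega> - r \<omega>) \<omega> (Suc m)) / real (Suc m))
    \<in> borel_measurable M" for m
  proof -
    have "(\<lambda>\<omega>. queue_state th sg s S (Suc m) (y \<omega> - r \<omega>) \<omega> (Suc m))
      \<in> F (grid s S (Suc m) (Suc m)) \<rightarrow>\<^sub>M borel \<Otimes>\<^sub>M borel"
      using assms by (intro queue_state_adapted) auto
    then have "(\<lambda>\<omega>. queue_state th sg s S (Suc m) (y \<omega> - r \<omega>) \<omega> (Suc m)) \<in> M \<rightarrow>\<^sub>M borel \<Otimes>\<^sub>M borel"
      using assms by (intro measurable_F_M[where s = "grid s S (Suc m) (Suc m)"]) (auto simp: grid_end)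
    then show ?thesis by measurable
  qed
qed

text \<open>Boundedness of \<open>g\<close> gives dominated convergence. The same discrete quantities appear for every start
\<open>(s, y, r)\<close>; only their arguments \<open>y - r\<close> differ.\<close>

lemma queue_mean_cost_tendsto:
  assumes RBM: "reflected_BM F B th sg (space M) s y r Z Y" and s: "0 \<le> s" and S: "0 < S"
    and g: "continuous_on UNIV g" and bound: "\<And>a. g a \<le> K"
  shows "(\<lambda>m. \<integral>\<^sup>+ \<omega>. queue_mean_cost th sg S g (Suc m) (y \<omega> - r \<omega>) \<partial>M)
    \<longlonglongrightarrow> (\<integral>\<^sup>+ \<omega>. ennreal (g (1 / S * (LBINT t:{s..<s + S}. Z t \<omega> - r \<omega>))) \<partial>M)"
proof -
  have [measurable]: "y \<in> borel_measurable (F s)" "r \<in> borel_measurable (F s)"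
    using RBM by (auto simp: reflected_BM_def)
  have [measurable]: "g \<in> borel_measurable borel"
    using g by (rule borel_measurable_continuous_onI)
  let ?q = "\<lambda>m \<omega>. snd (queue_state th sg s S (Suc m) (y \<omega> - r \<omega>) \<omega> (Suc m)) / real (Suc m)"
  let ?A = "\<lambda>\<omega>. 1 / S * (LBINT t:{s..<s + S}. Z t \<omega> - r \<omega>)"
  have [measurable]: "?A \<in> borel_measurable M"
    using RBM s S by (rule time_average_measurable)
  have [measurable]: "(\<lambda>\<omega>. queue_state th sg s S (Suc m) (y \<omega> - r \<omega>) \<omega> (Suc m))
      \<in> M \<rightarrow>\<^sub>M borel \<Otimes>\<^sub>M borel" for m
    using s S by (intro measurable_F_M[where s = "grid s S (Suc m) (Suc m)"] queue_state_adapted)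
      (auto simp: grid_end)
  have gA: "(\<lambda>\<omega>. ennreal (g (?A \<omega>))) \<in> borel_measurable M"
    by measurable
  have "(\<lambda>m. \<integral>\<^sup>+ \<omega>. ennreal (g (?q m \<omega>)) \<partial>M) \<longlonglongrightarrow> (\<integral>\<^sup>+ \<omega>. ennreal (g (?A \<omega>)) \<partial>M)"
  proof (rule nn_integral_dominated_convergence[where w = "\<lambda>_. ennreal K"])
    show "AE \<omega> in M. (\<lambda>m. ennreal (g (?q m \<omega>))) \<longlonglongrightarrow> ennreal (g (?A \<omega>))"
    proof (rule AE_I2)
      fix \<omega> assume "\<omega> \<in> space M"
      then have "(\<lambda>m. ?q m \<omega>) \<longlonglongrightarrow> ?A \<omega>"
        by (intro LIMSEQ_Suc queue_state_tendsto_mean[OF RBM _ S])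
      then have "(\<lambda>m. g (?q m \<omega>)) \<longlonglongrightarrow> g (?A \<omega>)"
        by (rule continuous_on_tendsto_compose[OF g]) auto
      then show "(\<lambda>m. ennreal (g (?q m \<omega>))) \<longlonglongrightarrow> ennreal (g (?A \<omega>))"
        by (rule tendsto_ennrealI)
    qed
  qed (use gA in \<open>auto simp: bound ennreal_leI emeasure_space_1\<close>)
  moreover have "(\<integral>\<^sup>+ \<omega>. ennreal (g (?q m \<omega>)) \<partial>M)
    = (\<integral>\<^sup>+ \<omega>. queue_mean_cost th sg S g (Suc m) (y \<omega> - r \<omega>) \<partial>M)" for m
    using s S by (intro nn_integral_queue_mean) auto
  ultimately show ?thesis by simp
qed

text \<open>The Markov property in the form in which it is needed. For a bounded cost, the discretised
expectation after the random start is the mean over \<open>\<omega>\<close> of a function of \<open>y \<omega> - r \<omega>\<close>; for each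
\<open>\<omega>\<close> the latter converges to the expected cost for the deterministic start
\<open>(y \<omega>, r \<omega>)\<close> at time \<open>0\<close>, which the hypothesis bounds. A general cost is truncated at \<open>K\<close> first.
The truncation makes the discretised expectations for the deterministic starts converge; they must
be bounded from above in the limit, which Fatou's lemma does not give.\<close>

lemma time_average_bound_from_random_start:
  assumes RBM: "reflected_BM F B th sg (space M) s y r Z Y" and s: "0 \<le> s" and S: "0 < S"
    and g: "continuous_on UNIV g" and R: "\<And>\<omega>. \<omega> \<in> space M \<Longrightarrow> r \<omega> \<in> R"
    and bound: "\<And>r0 y0 Zr Yr. r0 \<in> R \<Longrightarrow> r0 \<le> y0 \<Longrightarrow>
      reflected_BM F B th sg (space M) 0 (\<lambda>_. y0) (\<lambda>_. r0) Zr Yr \<Longrightarrow>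
      (\<integral>\<^sup>+ \<omega>. ennreal (g (1 / S * (LBINT t:{0..<S}. Zr t \<omega> - r0))) \<partial>M) \<le> b y0"
  shows "(\<integral>\<^sup>+ \<omega>. ennreal (g (1 / S * (LBINT t:{s..<s + S}. Z t \<omega> - r \<omega>))) \<partial>M)
    \<le> (\<integral>\<^sup>+ \<omega>. b (y \<omega>) \<partial>M)"
proof -
  have [measurable]: "y \<in> borel_measurable M" "r \<in> borel_measurable M"
    using RBM s by (auto simp: reflected_BM_def intro: measurable_F_M)
  have g_meas [measurable]: "g \<in> borel_measurable borel"
    using g by (rule borel_measurable_continuous_onI)
  let ?A = "\<lambda>\<omega>. 1 / S * (LBINT t:{s..<s + S}. Z t \<omega> - r \<omega>)"
  have [measurable]: "?A \<in> borel_measurable M"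
    using RBM s S by (rule time_average_measurable)
  have truncated: "(\<integral>\<^sup>+ \<omega>. ennreal (min (g (?A \<omega>)) K) \<partial>M) \<le> (\<integral>\<^sup>+ \<omega>. b (y \<omega>) \<partial>M)" for K
  proof -
    define f where "f = (\<lambda>a. min (g a) K)"
    have f: "continuous_on UNIV f" "\<And>a. f a \<le> K"
      unfolding f_def by (auto intro!: continuous_intros g)
    then have [measurable]: "f \<in> borel_measurable borel"
      by (intro borel_measurable_continuous_onI)
    let ?G = "\<lambda>m. queue_mean_cost th sg S f (Suc m)"
    have [measurable]: "?G m \<in> borel_measurable borel" for m
      using S by (intro queue_mean_cost_measurable) auto
    have G_le: "?G m z \<le> ennreal K" for m z
    proof -
      have "?G m z \<le> (\<integral>\<^sup>+ \<omega>. ennreal K \<partial>M)"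
        unfolding queue_mean_cost_eq[OF S zero_less_Suc \<open>f \<in> borel_measurable borel\<close>]
        by (intro nn_integral_mono ennreal_leI f)
      then show ?thesis by (simp add: emeasure_space_1)
    qed
    \<comment> \<open>The limit is the truncated cost for the deterministic start in \<open>y \<omega>\<close> with barrier \<open>r \<omega>\<close>.\<close>
    have limit: "\<exists>l. (\<lambda>m. ?G m (y \<omega> - r \<omega>)) \<longlonglongrightarrow> l \<and> l \<le> b (y \<omega>)" if \<omega>: "\<omega> \<in> space M" for \<omega>
    proof -
      have "r \<omega> \<le> y \<omega>"
        using RBM \<omega> by (auto simp: reflected_BM_def)
      then obtain Zr Yr where Zr: "reflected_BM F B th sg (space M) 0 (\<lambda>_. y \<omega>) (\<lambda>_. r \<omega>) Zr Yr"
        using reflected_BM_exists by blast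
      have "(\<lambda>m. ?G m (y \<omega> - r \<omega>))
        \<longlonglongrightarrow> (\<integral>\<^sup>+ \<omega>'. ennreal (f (1 / S * (LBINT t:{0..<S}. Zr t \<omega>' - r \<omega>))) \<partial>M)"
        using queue_mean_cost_tendsto[OF Zr order_refl S f] by (simp add: emeasure_space_1)
      moreover have "(\<integral>\<^sup>+ \<omega>'. ennreal (f (1 / S * (LBINT t:{0..<S}. Zr t \<omega>' - r \<omega>))) \<partial>M)
        \<le> (\<integral>\<^sup>+ \<omega>'. ennreal (g (1 / S * (LBINT t:{0..<S}. Zr t \<omega>' - r \<omega>))) \<partial>M)"
        by (intro nn_integral_mono ennreal_leI) (simp add: f_def)
      ultimately show ?thesis
        using bound[OF R[OF \<omega>] \<open>r \<omega> \<le> y \<omega>\<close> Zr] by (auto intro: order_trans)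
    qed
    \<comment> \<open>The lower limit serves as a version of the limit that is visibly measurable in \<open>\<omega>\<close>.\<close>
    let ?l = "\<lambda>\<omega>. liminf (\<lambda>m. ?G m (y \<omega> - r \<omega>))"
    have l: "(\<lambda>m. ?G m (y \<omega> - r \<omega>)) \<longlonglongrightarrow> ?l \<omega>" "?l \<omega> \<le> b (y \<omega>)" if "\<omega> \<in> space M" for \<omega>
      using limit[OF that] lim_imp_Liminf[OF sequentially_bot] by auto
    have "(\<lambda>m. \<integral>\<^sup>+ \<omega>. ?G m (y \<omega> - r \<omega>) \<partial>M) \<longlonglongrightarrow> (\<integral>\<^sup>+ \<omega>. ?l \<omega> \<partial>M)"
      by (rule nn_integral_dominated_convergence[where w = "\<lambda>_. ennreal K"])
        (auto simp: G_le emeasure_space_1 intro!: AE_I2 l(1))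
    with queue_mean_cost_tendsto[OF RBM s S f]
    have "(\<integral>\<^sup>+ \<omega>. ennreal (f (?A \<omega>)) \<partial>M) = (\<integral>\<^sup>+ \<omega>. ?l \<omega> \<partial>M)"
      by (rule LIMSEQ_unique)
    also have "\<dots> \<le> (\<integral>\<^sup>+ \<omega>. b (y \<omega>) \<partial>M)"
      by (intro nn_integral_mono l(2))
    finally show ?thesis by (simp add: f_def)
  qed
  have "(\<integral>\<^sup>+ \<omega>. ennreal (g (?A \<omega>)) \<partial>M)
    = (\<integral>\<^sup>+ \<omega>. liminf (\<lambda>k. ennreal (min (g (?A \<omega>)) (real k))) \<partial>M)"
  proof (intro nn_integral_cong)
    fix \<omega>
    have "\<forall>\<^sub>F k in sequentially. g (?A \<omega>) \<le> real k"
      using filterlim_real_sequentially by (simp add: filterlim_at_top)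
    then have "\<forall>\<^sub>F k in sequentially. ennreal (min (g (?A \<omega>)) (real k)) = ennreal (g (?A \<omega>))"
      by eventually_elim (simp add: min_def)
    then have "(\<lambda>k. ennreal (min (g (?A \<omega>)) (real k))) \<longlonglongrightarrow> ennreal (g (?A \<omega>))"
      by (rule tendsto_eventually)
    then show "ennreal (g (?A \<omega>)) = liminf (\<lambda>k. ennreal (min (g (?A \<omega>)) (real k)))"
      using lim_imp_Liminf[OF sequentially_bot] by metis
  qed
  also have "\<dots> \<le> liminf (\<lambda>k. \<integral>\<^sup>+ \<omega>. ennreal (min (g (?A \<omega>)) (real k)) \<partial>M)"
    by (rule nn_integral_liminf) measurable
  also have "\<dots> \<le> (\<integral>\<^sup>+ \<omega>. b (y \<omega>) \<partial>M)"
    by (rule Liminf_le[OF sequentially_bot]) (intro always_eventually allI truncated)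
  finally show ?thesis .
qed

text \<open>The exponential law with rate \<open>g\<close> is stationary for the reflected process and dominates Lindley's
recursion. The induction step rests on \<open>E exp (g \<xi>) = 1\<close> for the increment \<open>\<xi>\<close> with mean
\<open>th * S / n\<close> and variance \<open>sg\<^sup>2 * S / n\<close>; this is the choice of \<open>g\<close>. The bound is uniform in the mesh
and in the number of steps, hence survives the passage to continuous time.\<close>

lemma lindley_exponential_tail:
  assumes s: "0 \<le> s" and S: "0 < S" and n: "0 < n" and sg: "0 < sg"
    and g: "g = - 2 * th / sg\<^sup>2" "0 < g"
  shows "emeasure M {\<omega> \<in> space M. a \<le> lindley 0 (increment th sg s S n \<omega>) j} \<le> ennreal (exp (- g * a))"
proof (induction j arbitrary: a)
  case 0
  show ?case
  proof (cases "a \<le> 0")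
    case True
    then have "1 \<le> exp (- g * a)"
      using g(2) by (simp add: mult_nonneg_nonpos)
    with True show ?thesis by (simp add: emeasure_space_1)
  qed simp
next
  case (Suc j)
  let ?L = "\<lambda>\<omega> j. lindley 0 (increment th sg s S n \<omega>) j"
  let ?d = "S / real n"
  show ?case
  proof (cases "a \<le> 0")
    case True
    then have "1 \<le> exp (- g * a)"
      using g(2) by (simp add: mult_nonneg_nonpos)
    then have "1 \<le> ennreal (exp (- g * a))"
      using ennreal_leI by fastforce
    then show ?thesis
      using emeasure_le_1 by (rule order_trans[rotated])
  next
    case False
    have t: "0 \<le> grid s S n j" "grid s S n j < grid s S n (Suc j)"
      using s S n by (auto simp: grid_def divide_strict_right_mono)
    have d: "grid s S n (Suc j) - grid s S n j = ?d"
      by (simp add: grid_Suc)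
    have "(\<lambda>\<omega>. fst (queue_state th sg s S n 0 \<omega> j)) \<in> borel_measurable (F (grid s S n j))"
      using queue_state_adapted[OF s S n, of "\<lambda>_. 0" th sg j] by measurable
    then have L_F: "(\<lambda>\<omega>. ?L \<omega> j) \<in> borel_measurable (F (grid s S n j))"
      by (simp add: queue_state_def)
    then have [measurable]: "(\<lambda>\<omega>. ?L \<omega> j) \<in> borel_measurable M"
      using t by (intro measurable_F_M)
    have [measurable]: "B (grid s S n j) \<in> borel_measurable M"
      "B (grid s S n (Suc j)) \<in> borel_measurable M"
      using t by (auto intro!: B_measurable)
    let ?\<Phi> = "indicator {q. a \<le> fst q + (th * ?d + sg * snd q)} :: real \<times> real \<Rightarrow> ennreal"
    have [measurable]: "?\<Phi> \<in> borel_measurable (borel \<Otimes>\<^sub>M borel)"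
      by measurable
    have "emeasure M {\<omega> \<in> space M. a \<le> ?L \<omega> (Suc j)} = emeasure M {\<omega> \<in> space M. a \<le> ?L \<omega> j
        + (th * ?d + sg * (B (grid s S n (Suc j)) \<omega> - B (grid s S n j) \<omega>))}"
      using False by (intro arg_cong[where f = "emeasure M"]) (auto simp: increment_def)
    also have "\<dots> = (\<integral>\<^sup>+ \<omega>. indicator {\<omega> \<in> space M. a \<le> ?L \<omega> j
        + (th * ?d + sg * (B (grid s S n (Suc j)) \<omega> - B (grid s S n j) \<omega>))} \<omega> \<partial>M)"
      by (rule nn_integral_indicator[symmetric]) measurable
    also have "\<dots> = (\<integral>\<^sup>+ \<omega>. ?\<Phi> (?L \<omega> j, B (grid s S n (Suc j)) \<omega> - B (grid s S n j) \<omega>) \<partial>M)"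
      by (intro nn_integral_cong) (simp add: indicator_def)
    also have "\<dots> = (\<integral>\<^sup>+ x. (\<integral>\<^sup>+ \<omega>. ?\<Phi> (?L \<omega> j, x) \<partial>M) \<partial>gaussian ?d)"
      using nn_integral_independent_increment'[OF t(1,2) L_F \<open>?\<Phi> \<in> _\<close>] unfolding d .
    also have "\<dots> = (\<integral>\<^sup>+ x. emeasure M {\<omega> \<in> space M. a - th * ?d - sg * x \<le> ?L \<omega> j} \<partial>gaussian ?d)"
    proof (intro nn_integral_cong)
      fix x
      have "(\<integral>\<^sup>+ \<omega>. ?\<Phi> (?L \<omega> j, x) \<partial>M)
        = (\<integral>\<^sup>+ \<omega>. indicator {\<omega> \<in> space M. a - th * ?d - sg * x \<le> ?L \<omega> j} \<omega> \<partial>M)"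
        by (intro nn_integral_cong) (simp add: indicator_def algebra_simps)
      also have "\<dots> = emeasure M {\<omega> \<in> space M. a - th * ?d - sg * x \<le> ?L \<omega> j}"
        by (rule nn_integral_indicator) measurable
      finally show "(\<integral>\<^sup>+ \<omega>. ?\<Phi> (?L \<omega> j, x) \<partial>M)
        = emeasure M {\<omega> \<in> space M. a - th * ?d - sg * x \<le> ?L \<omega> j}" .
    qed
    also have "\<dots> \<le> (\<integral>\<^sup>+ x. ennreal (exp (- g * (a - th * ?d - sg * x))) \<partial>gaussian ?d)"
      by (intro nn_integral_mono Suc.IH)
    also have "\<dots> = (\<integral>\<^sup>+ x. ennreal (exp (- g * a + g * th * ?d)) * ennreal (exp ((g * sg) * x)) \<partial>gaussian ?d)"
      by (intro nn_integral_cong) (simp add: ennreal_mult'[symmetric] exp_add[symmetric] algebra_simps)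
    also have "\<dots> = ennreal (exp (- g * a + g * th * ?d)) * ennreal (exp ((g * sg)\<^sup>2 * ?d / 2))"
      using S n by (subst nn_integral_cmult) (auto simp: gaussian_exp_moment)
    also have "\<dots> = ennreal (exp (- g * a))"
    proof -
      \<comment> \<open>The drift and the variance cancel in the exponent.\<close>
      have "(g * sg)\<^sup>2 = g * (g * sg\<^sup>2)"
        by (simp add: power2_eq_square)
      also have "g * sg\<^sup>2 = - 2 * th"
        using sg g by simp
      finally have "(g * sg)\<^sup>2 * ?d / 2 = - (g * th * ?d)"
        by simp
      then show ?thesis
        by (simp only: ennreal_mult'[symmetric] exp_ge_zero exp_add[symmetric]) simp
    qed
    finally show ?thesis .
  qed
qed

lemma reflected_BM_fourth_moment:
  assumes RBM: "reflected_BM F B th sg (space M) 0 (\<lambda>_. 0) (\<lambda>_. 0) Z Y" and t: "0 \<le> t"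
    and sg: "0 < sg" and g: "g = - 2 * th / sg\<^sup>2" "0 < g"
  shows "(\<integral>\<^sup>+ \<omega>. ennreal (Z t \<omega> ^ 4) \<partial>M) \<le> ennreal (fact 4 / g ^ 4)"
proof (cases "t = 0")
  case True
  have "Z t \<omega> = 0" if "\<omega> \<in> space M" for \<omega>
    using reflected_path.w_start[OF reflected_BM_path[OF RBM that]] True by simp
  then have "(\<integral>\<^sup>+ \<omega>. ennreal (Z t \<omega> ^ 4) \<partial>M) = (\<integral>\<^sup>+ \<omega>. 0 \<partial>M)"
    by (intro nn_integral_cong) simp
  then show ?thesis by simp
next
  case False
  with t have t: "0 < t" by simp
  let ?L = "\<lambda>m \<omega>. lindley 0 (increment th sg 0 t (Suc m) \<omega>) (Suc m)"
  have L_measurable [measurable]: "?L m \<in> borel_measurable M" for m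
  proof -
    have "(\<lambda>\<omega>. queue_state th sg 0 t (Suc m) 0 \<omega> (Suc m)) \<in> M \<rightarrow>\<^sub>M borel \<Otimes>\<^sub>M borel"
      using t by (intro measurable_F_M[where s = "grid 0 t (Suc m) (Suc m)"] queue_state_adapted)
        (auto simp: grid_end)
    then have "(\<lambda>\<omega>. fst (queue_state th sg 0 t (Suc m) 0 \<omega> (Suc m))) \<in> borel_measurable M"
      by measurable
    then show ?thesis by (simp add: queue_state_def)
  qed
  have "(\<integral>\<^sup>+ \<omega>. ennreal (Z t \<omega> ^ 4) \<partial>M) = (\<integral>\<^sup>+ \<omega>. liminf (\<lambda>m. ennreal (?L m \<omega> ^ 4)) \<partial>M)"
  proof (intro nn_integral_cong)
    fix \<omega> assume "\<omega> \<in> space M"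
    then have "(\<lambda>m. ?L m \<omega>) \<longlonglongrightarrow> Z t \<omega>"
      using LIMSEQ_Suc[OF queue_state_tendsto_end[OF RBM, of \<omega> t]] t by (simp add: queue_state_def)
    then have "(\<lambda>m. ennreal (?L m \<omega> ^ 4)) \<longlonglongrightarrow> ennreal (Z t \<omega> ^ 4)"
      by (intro tendsto_ennrealI tendsto_power)
    then show "ennreal (Z t \<omega> ^ 4) = liminf (\<lambda>m. ennreal (?L m \<omega> ^ 4))"
      using lim_imp_Liminf[OF sequentially_bot] by metis
  qed
  also have "\<dots> \<le> liminf (\<lambda>m. \<integral>\<^sup>+ \<omega>. ennreal (?L m \<omega> ^ 4) \<partial>M)"
    by (rule nn_integral_liminf) measurable
  also have "\<dots> \<le> ennreal (fact 4 / g ^ 4)"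
  proof (rule Liminf_le[OF sequentially_bot], rule always_eventually, rule allI)
    show "(\<integral>\<^sup>+ \<omega>. ennreal (?L m \<omega> ^ 4) \<partial>M) \<le> ennreal (fact 4 / g ^ 4)" for m
    proof (rule fourth_moment_of_exponential_tail[OF prob_space_axioms L_measurable g(2)])
      show "emeasure M {\<omega> \<in> space M. a \<le> ?L m \<omega>} \<le> ennreal (exp (- g * a))" for a
        using t sg g by (intro lindley_exponential_tail) auto
    qed simp
  qed
  finally show ?thesis .
qed

end


section \<open>The error of the estimated rate\<close>

text \<open>Apart from the truncation at \<open>gl \<le> g\<close>, which only decreases the error, \<open>u\<close> is \<open>1 / A\<close>, and
\<open>u - g = g * u * (1 / g - 1 / u)\<close>. Cutting the error off at \<open>e\<close> replaces the unbounded factor \<open>u\<close>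
by \<open>g + e\<close>, and treats small and large deviations at once. For \<open>A = 0\<close> the estimate is
\<open>gl\<close>, and the right-hand side is \<open>g + e\<close>.\<close>

lemma estimate_error_le:
  fixes A g gl e u :: real
  assumes "0 \<le> A" "0 < gl" "gl \<le> g" "0 < e" and u: "u = max (inverse A) gl"
  shows "min \<bar>u - g\<bar> e \<le> g * (g + e) * \<bar>A - 1 / g\<bar>"
proof (cases "A = 0")
  case True
  have "e \<le> g * (g + e) * \<bar>A - 1 / g\<bar>"
    using assms True by simp
  then show ?thesis by simp
next
  case False
  have pos: "0 < A" "0 < g" "0 < u"
    using assms False by (auto simp: max_def)
  show ?thesis
  proof (cases "u \<le> g")
    case True
    have "inverse A \<le> u"
      by (simp add: u)
    then have "1 / u \<le> A"
      using pos by (simp add: field_simps)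
    moreover have "1 / u - 1 / g = (g - u) / (g * u)"
      using pos by (simp add: field_simps)
    ultimately have "(g - u) / (g * u) \<le> \<bar>A - 1 / g\<bar>"
      by linarith
    then have "g - u \<le> g * u * \<bar>A - 1 / g\<bar>"
      using pos by (simp add: pos_divide_le_eq mult.commute)
    also have "\<dots> \<le> g * (g + e) * \<bar>A - 1 / g\<bar>"
      using True pos \<open>0 < e\<close> by (intro mult_right_mono mult_left_mono) auto
    finally show ?thesis
      using True by simp
  next
    case False
    \<comment> \<open>Since \<open>1 / g - 1 / v\<close> increases in \<open>v\<close>, the estimate \<open>u\<close> may be lowered to \<open>g + e\<close>.\<close>
    define v where "v = min u (g + e)"
    have v: "g < v" "v \<le> g + e" "v - g = min \<bar>u - g\<bar> e" "v \<le> u"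
      using False \<open>0 < e\<close> by (auto simp: v_def min_def)
    have "u = inverse A"
      using False assms by (auto simp: max_def)
    then have "A = 1 / u"
      by (simp add: divide_inverse)
    then have "A \<le> 1 / v"
      using v pos by (simp add: frac_le)
    moreover have "1 / g - 1 / v = (v - g) / (g * v)"
      using pos v(1) by (simp add: field_simps)
    ultimately have "(v - g) / (g * v) \<le> \<bar>A - 1 / g\<bar>"
      by linarith
    then have "v - g \<le> g * v * \<bar>A - 1 / g\<bar>"
      using pos v by (simp add: pos_divide_le_eq mult.commute)
    also have "\<dots> \<le> g * (g + e) * \<bar>A - 1 / g\<bar>"
      using v pos by (intro mult_right_mono mult_left_mono) auto
    finally show ?thesis
      by (simp only: v(3))
  qed
qed

section \<open>The algorithm\<close>

lemma C_cost_nonneg: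
  assumes "\<And>z. 0 \<le> h z" "0 \<le> u"
  shows "0 \<le> C_cost h u r"
  unfolding C_cost_def set_lebesgue_integral_def
  using assms by (intro mult_nonneg_nonneg integral_nonneg) (auto simp: indicator_def)

lemma dtau_ge_1: "1 \<le> dtau k" and tau_nonneg: "0 \<le> tau k" and tau_Suc: "tau (Suc k) = tau k + dtau k"
  by (simp_all add: tau_def dtau_def)

lemma tau_0: "tau 0 = 0"
  by (simp add: tau_def)

text \<open>On one period the algorithm runs a single reflected Brownian motion up to and including the end of
the period, since the left limit of \<open>Z\<close> is the value of the continuous \<open>Zk\<close>.\<close>

lemma AU_period:
  assumes AU: "AU_algorithm F B th sg \<Omega> h gl x Z ghat rhat X"
  obtains Zk Yk where "reflected_BM F B th sg \<Omega> (tau k) (X k) (rhat k) Zk Yk"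
    "\<And>\<omega>. \<omega> \<in> \<Omega> \<Longrightarrow> ghat (Suc k) \<omega> =
      max (inverse (1 / dtau k * (LBINT t:{tau k..<tau k + dtau k}. Zk t \<omega> - rhat k \<omega>))) gl"
    "\<And>\<omega>. \<omega> \<in> \<Omega> \<Longrightarrow> rhat (Suc k) \<omega> = r_opt h (ghat (Suc k) \<omega>)"
    "\<And>\<omega>. \<omega> \<in> \<Omega> \<Longrightarrow> X (Suc k) \<omega> = max (Zk (tau (Suc k)) \<omega>) (rhat (Suc k) \<omega>)"
proof -
  obtain Zk Yk where RBM: "reflected_BM F B th sg \<Omega> (tau k) (X k) (rhat k) Zk Yk"
    and eq: "\<And>\<omega> t. \<omega> \<in> \<Omega> \<Longrightarrow> t \<in> {tau k..<tau (Suc k)} \<Longrightarrow> Z t \<omega> = Zk t \<omega>"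
    using AU unfolding AU_algorithm_def by blast
  have mean: "(LBINT t:{tau k..<tau (Suc k)}. Z t \<omega> - rhat k \<omega>)
      = (LBINT t:{tau k..<tau k + dtau k}. Zk t \<omega> - rhat k \<omega>)" if "\<omega> \<in> \<Omega>" for \<omega>
    unfolding tau_Suc[symmetric] by (rule set_lebesgue_integral_cong) (auto simp: eq that)
  have lim: "Lim (at_left (tau (Suc k))) (\<lambda>t. Z t \<omega>) = Zk (tau (Suc k)) \<omega>" if \<omega>: "\<omega> \<in> \<Omega>" for \<omega>
  proof (rule tendsto_Lim)
    have less: "tau k < tau (Suc k)"
      using dtau_ge_1[of k] by (simp add: tau_Suc)
    have "continuous_on {tau k..} (\<lambda>t. Zk t \<omega>)"
      using RBM \<omega> by (auto simp: reflected_BM_def)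
    then have "((\<lambda>t. Zk t \<omega>) \<longlongrightarrow> Zk (tau (Suc k)) \<omega>) (at (tau (Suc k)) within {tau k..})"
      using less by (auto simp: continuous_on_def)
    then have "((\<lambda>t. Zk t \<omega>) \<longlongrightarrow> Zk (tau (Suc k)) \<omega>) (at (tau (Suc k)))"
      using less by (subst (asm) at_within_interior) auto
    then have "((\<lambda>t. Zk t \<omega>) \<longlongrightarrow> Zk (tau (Suc k)) \<omega>) (at_left (tau (Suc k)))"
      by (rule tendsto_mono[rotated]) (simp add: at_le)
    moreover have "\<forall>\<^sub>F t in at_left (tau (Suc k)). Zk t \<omega> = Z t \<omega>"
      using eventually_at_left_real[OF less] by eventually_elim (simp add: eq \<omega>)
    ultimately show "((\<lambda>t. Z t \<omega>) \<longlongrightarrow> Zk (tau (Suc k)) \<omega>) (at_left (tau (Suc k)))"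
      by (rule Lim_transform_eventually)
  qed simp
  show thesis
    using AU mean lim unfolding AU_algorithm_def by (intro that[OF RBM]) auto
qed

context brownian
begin

text \<open>Comparison with the Brownian motion \<open>R\<close> reflected at \<open>0\<close>: the barriers \<open>rhat k\<close> never exceed \<open>0\<close>, so
while the state is positive it is not pushed at all, and increases no more than \<open>R\<close> does. The
upward jump to a new barrier at the end of a period does not lead above \<open>0\<close>.\<close>

lemma AU_state_le:
  assumes AU: "AU_algorithm F B th sg (space M) h gl x Z ghat rhat X"
    and R: "reflected_BM F B th sg (space M) 0 (\<lambda>_. 0) (\<lambda>_. 0) R Y0"
    and x: "0 \<le> x" and rhat: "\<And>k. rhat k \<omega> \<le> 0" and \<omega>: "\<omega> \<in> space M"
  shows "X k \<omega> \<le> x + R (tau k) \<omega>"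
proof (induction k)
  case 0
  have "R 0 \<omega> = 0"
    using reflected_path.w_start[OF reflected_BM_path[OF R \<omega>]] by simp
  then show ?case
    using AU \<omega> by (simp add: AU_algorithm_def tau_0)
next
  case (Suc k)
  obtain Zk Yk where RBM: "reflected_BM F B th sg (space M) (tau k) (X k) (rhat k) Zk Yk"
    and X: "X (Suc k) \<omega> = max (Zk (tau (Suc k)) \<omega>) (rhat (Suc k) \<omega>)"
    using AU_period[OF AU, of k] \<omega> by metis
  interpret R: reflected_path 0 "\<lambda>t. th * (t - 0) + sg * (B t \<omega> - B 0 \<omega>)" 0 0
      "\<lambda>t. R t \<omega>" "\<lambda>t. Y0 t \<omega>"
    using R \<omega> by (rule reflected_BM_path)
  interpret Z: reflected_path "tau k" "\<lambda>t. th * (t - tau k) + sg * (B t \<omega> - B (tau k) \<omega>)"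
      "X k \<omega>" "rhat k \<omega>" "\<lambda>t. Zk t \<omega>" "\<lambda>t. Yk t \<omega>"
    using RBM \<omega> by (rule reflected_BM_path)
  have times: "0 \<le> tau k" "tau k \<le> tau (Suc k)"
    using tau_nonneg dtau_ge_1[of k] by (auto simp: tau_Suc)
  have "Zk (tau (Suc k)) \<omega> \<le> x + R (tau (Suc k)) \<omega>"
    using Z.excursion_cases[OF order_refl times(2) rhat]
  proof
    assume "Zk (tau (Suc k)) \<omega> = Zk (tau k) \<omega>
      + (th * (tau (Suc k) - tau k) + sg * (B (tau (Suc k)) \<omega> - B (tau k) \<omega>))
      - (th * (tau k - tau k) + sg * (B (tau k) \<omega> - B (tau k) \<omega>))"
    then show ?thesis
      using Suc Z.w_start R.increment_ge[OF times] by (simp add: algebra_simps)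
  next
    assume "\<exists>u\<in>{tau k..tau (Suc k)}. Zk u \<omega> \<le> 0 \<and> Zk (tau (Suc k)) \<omega> = Zk u \<omega>
      + (th * (tau (Suc k) - tau k) + sg * (B (tau (Suc k)) \<omega> - B (tau k) \<omega>))
      - (th * (u - tau k) + sg * (B u \<omega> - B (tau k) \<omega>))"
    then obtain u where u: "tau k \<le> u" "u \<le> tau (Suc k)" "Zk u \<omega> \<le> 0"
      "Zk (tau (Suc k)) \<omega> = Zk u \<omega>
      + (th * (tau (Suc k) - tau k) + sg * (B (tau (Suc k)) \<omega> - B (tau k) \<omega>))
      - (th * (u - tau k) + sg * (B u \<omega> - B (tau k) \<omega>))"
      by auto
    then show ?thesis
      using R.increment_ge[of u "tau (Suc k)"] R.ge_barrier[of u] times x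
      by (simp add: algebra_simps)
  qed
  moreover have "0 \<le> R (tau (Suc k)) \<omega>"
    using times by (intro R.ge_barrier) simp
  ultimately show ?case
    using X rhat[of "Suc k"] x by simp
qed

text \<open>The state lies between \<open>- K\<close> and \<open>x + R\<close>, and the fourth moment of \<open>R\<close> is bounded uniformly in time.\<close>

lemma AU_state_fourth_moment:
  assumes AU: "AU_algorithm F B th sg (space M) h gl x Z ghat rhat X"
    and sg: "0 < sg" and g: "g = - 2 * th / sg\<^sup>2" "0 < g" and x: "0 \<le> x"
    and rhat: "\<And>k \<omega>. \<omega> \<in> space M \<Longrightarrow> rhat k \<omega> \<in> {- K..0}"
  shows "(\<integral>\<^sup>+ \<omega>. ennreal (1 + \<bar>X k \<omega>\<bar> ^ 4) \<partial>M)
    \<le> ennreal (1 + K ^ 4 + 8 * (x ^ 4 + fact 4 / g ^ 4))"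
proof -
  obtain R Y0 where R: "reflected_BM F B th sg (space M) 0 (\<lambda>_. 0) (\<lambda>_. 0) R Y0"
    using reflected_BM_exists[of 0 0 th sg] by auto
  have [measurable]: "R (tau k) \<in> borel_measurable M"
    using R tau_nonneg[of k] by (auto simp: reflected_BM_def intro: measurable_F_M)
  have bound: "1 + \<bar>X k \<omega>\<bar> ^ 4 \<le> (1 + K ^ 4 + 8 * x ^ 4) + 8 * R (tau k) \<omega> ^ 4" if \<omega>: "\<omega> \<in> space M" for \<omega>
  proof -
    have le: "X k \<omega> \<le> x + R (tau k) \<omega>"
      using AU_state_le[OF AU R x] rhat \<omega> by fastforce
    have R0: "0 \<le> R (tau k) \<omega>"
      by (rule reflected_path.ge_barrier[OF reflected_BM_path[OF R \<omega>] tau_nonneg])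
    obtain Zk Yk where "reflected_BM F B th sg (space M) (tau k) (X k) (rhat k) Zk Yk"
      by (rule AU_period[OF AU, of k])
    then have ge: "- K \<le> X k \<omega>"
      using rhat[OF \<omega>, of k] \<omega> by (force simp: reflected_BM_def)
    have convex: "(x + R (tau k) \<omega>) ^ 4 \<le> 8 * (x ^ 4 + R (tau k) \<omega> ^ 4)"
    proof -
      have sq: "(a + b)\<^sup>2 \<le> 2 * (a\<^sup>2 + b\<^sup>2)" for a b :: real
        using zero_le_power2[of "a - b"] by (simp add: power2_eq_square algebra_simps)
      have "(x + R (tau k) \<omega>) ^ 4 = ((x + R (tau k) \<omega>)\<^sup>2)\<^sup>2"
        by simp
      also have "\<dots> \<le> (2 * (x\<^sup>2 + (R (tau k) \<omega>)\<^sup>2))\<^sup>2"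
        by (intro power_mono sq) simp
      also have "\<dots> = 4 * (x\<^sup>2 + (R (tau k) \<omega>)\<^sup>2)\<^sup>2"
        by (subst power_mult_distrib) simp
      also have "\<dots> \<le> 4 * (2 * ((x\<^sup>2)\<^sup>2 + ((R (tau k) \<omega>)\<^sup>2)\<^sup>2))"
        by (intro mult_left_mono sq) simp
      finally show ?thesis by simp
    qed
    have K4: "0 \<le> K ^ 4"
      by simp
    show ?thesis
    proof (cases "0 \<le> X k \<omega>")
      case True
      then have "\<bar>X k \<omega>\<bar> ^ 4 \<le> (x + R (tau k) \<omega>) ^ 4"
        using le by (intro power_mono) auto
      from add_increasing[OF K4 order_trans[OF this convex]] show ?thesis
        by (simp add: algebra_simps)
    next
      case False
      then have "\<bar>X k \<omega>\<bar> ^ 4 \<le> K ^ 4"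
        using ge by (intro power_mono) auto
      then show ?thesis
        using x R0 by (simp add: add_increasing2)
    qed
  qed
  have "(\<integral>\<^sup>+ \<omega>. ennreal (1 + \<bar>X k \<omega>\<bar> ^ 4) \<partial>M)
    \<le> (\<integral>\<^sup>+ \<omega>. ennreal (1 + K ^ 4 + 8 * x ^ 4) + ennreal 8 * ennreal (R (tau k) \<omega> ^ 4) \<partial>M)"
  proof (rule nn_integral_mono)
    fix \<omega> assume "\<omega> \<in> space M"
    then have "ennreal (1 + \<bar>X k \<omega>\<bar> ^ 4) \<le> ennreal ((1 + K ^ 4 + 8 * x ^ 4) + 8 * R (tau k) \<omega> ^ 4)"
      by (intro ennreal_leI bound)
    also have "\<dots> = ennreal (1 + K ^ 4 + 8 * x ^ 4) + ennreal 8 * ennreal (R (tau k) \<omega> ^ 4)"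
      by (subst ennreal_plus) (auto simp: ennreal_mult)
    finally show "ennreal (1 + \<bar>X k \<omega>\<bar> ^ 4)
      \<le> ennreal (1 + K ^ 4 + 8 * x ^ 4) + ennreal 8 * ennreal (R (tau k) \<omega> ^ 4)" .
  qed
  also have "\<dots> = ennreal (1 + K ^ 4 + 8 * x ^ 4) + ennreal 8 * (\<integral>\<^sup>+ \<omega>. ennreal (R (tau k) \<omega> ^ 4) \<partial>M)"
    by (simp add: nn_integral_add nn_integral_cmult emeasure_space_1)
  also have "\<dots> \<le> ennreal (1 + K ^ 4 + 8 * x ^ 4) + ennreal 8 * ennreal (fact 4 / g ^ 4)"
    using R tau_nonneg sg g by (intro add_left_mono mult_left_mono reflected_BM_fourth_moment) auto
  also have "\<dots> = ennreal ((1 + K ^ 4 + 8 * x ^ 4) + 8 * (fact 4 / g ^ 4))"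
  proof -
    have q: "0 \<le> fact 4 / g ^ 4"
      using g(2) by simp
    have "ennreal 8 * ennreal (fact 4 / g ^ 4) = ennreal (8 * (fact 4 / g ^ 4))"
      by (rule ennreal_mult''[OF q, symmetric])
    moreover have "ennreal (1 + K ^ 4 + 8 * x ^ 4) + ennreal (8 * (fact 4 / g ^ 4))
      = ennreal ((1 + K ^ 4 + 8 * x ^ 4) + 8 * (fact 4 / g ^ 4))"
      using q by (intro ennreal_plus[symmetric]) auto
    ultimately show ?thesis by simp
  qed
  also have "(1 + K ^ 4 + 8 * x ^ 4) + 8 * (fact 4 / g ^ 4) = 1 + K ^ 4 + 8 * (x ^ 4 + fact 4 / g ^ 4)"
    by (simp add: algebra_simps)
  finally show ?thesis .
qed

end

section \<open>The learning regret\<close>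

theorem proposition7:
  fixes \<P> :: "'a measure" and F :: "real \<Rightarrow> 'a measure" and B :: "real \<Rightarrow> 'a \<Rightarrow> real"
    and \<theta> \<sigma> \<gamma> \<gamma>low :: real and h :: "real \<Rightarrow> real"
    and K\<^sub>h M \<epsilon>\<^sub>0 \<delta>\<^sub>0 L\<^sub>0 L\<^sub>1 C\<^sub>3 rstar x T :: real
    and Z :: "real \<Rightarrow> 'a \<Rightarrow> real" and \<gamma>hat rhat X :: "nat \<Rightarrow> 'a \<Rightarrow> real"
  assumes space: "filtered_prob_space \<P> F"
    and BM: "standard_BM \<P> F B"
    and parameters: "\<theta> < 0" "\<sigma> > 0" "\<gamma> = - 2 * \<theta> / \<sigma>\<^sup>2" "\<gamma>low > 0" "\<gamma>low \<le> \<gamma>"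
    and h: "holding_cost h \<gamma>low"
    and rstar: "rstar = r_opt h \<gamma>"
    and K\<^sub>h: "K\<^sub>h > 0" "\<And>u. u \<ge> \<gamma>low \<Longrightarrow> r_opt h u \<in> {- K\<^sub>h <..< 0}"
    and M: "\<And>r. r \<in> {- K\<^sub>h..0} \<Longrightarrow> C_cost h \<gamma> r \<le> M"
    and pos: "\<epsilon>\<^sub>0 > 0" "\<delta>\<^sub>0 > 0" "L\<^sub>0 > 0"
    and nbhd: "{rstar - \<delta>\<^sub>0 <..< rstar + \<delta>\<^sub>0} \<subseteq> {- K\<^sub>h <..< 0}"
    and L\<^sub>0: "\<And>u\<^sub>1 u\<^sub>2. u\<^sub>1 \<in> {\<gamma> - \<epsilon>\<^sub>0 <..< \<gamma> + \<epsilon>\<^sub>0} \<inter> {\<gamma>low..} \<Longrightarrow>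
        u\<^sub>2 \<in> {\<gamma> - \<epsilon>\<^sub>0 <..< \<gamma> + \<epsilon>\<^sub>0} \<inter> {\<gamma>low..} \<Longrightarrow>
        r_opt h u\<^sub>1 \<in> {rstar - \<delta>\<^sub>0 <..< rstar + \<delta>\<^sub>0} \<and>
        r_opt h u\<^sub>2 \<in> {rstar - \<delta>\<^sub>0 <..< rstar + \<delta>\<^sub>0} \<and>
        \<bar>r_opt h u\<^sub>1 - r_opt h u\<^sub>2\<bar> \<le> L\<^sub>0 * \<bar>u\<^sub>1 - u\<^sub>2\<bar>"
    and L\<^sub>1: "\<And>r. r \<in> {rstar - \<delta>\<^sub>0..rstar + \<delta>\<^sub>0} \<Longrightarrow>
        0 \<le> C_cost h \<gamma> r - C_cost h \<gamma> rstar \<and>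
        C_cost h \<gamma> r - C_cost h \<gamma> rstar \<le> L\<^sub>1 * (r - rstar)\<^sup>2"
    and C\<^sub>3: "\<And>r y S Zr Yr. r \<in> {- K\<^sub>h..0} \<Longrightarrow> r \<le> y \<Longrightarrow> 1 \<le> S \<Longrightarrow>
        reflected_BM F B \<theta> \<sigma> (space \<P>) 0 (\<lambda>_. y) (\<lambda>_. r) Zr Yr \<Longrightarrow>
        (\<integral>\<^sup>+ \<omega>. ennreal (\<bar>1 / S * (LBINT t:{0..S}. Zr t \<omega> - r) - 1 / \<gamma>\<bar>\<^sup>2) \<partial>\<P>)
          \<le> ennreal (C\<^sub>3 * (1 + \<bar>y\<bar> ^ 4) / S)"
    and AU: "AU_algorithm F B \<theta> \<sigma> (space \<P>) h \<gamma>low x Z \<gamma>hat rhat X"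
    and x: "x \<ge> 0" and T: "T \<ge> 1"
  shows "R3_AU \<P> h \<gamma> rhat T \<le>
    ennreal (2 * \<gamma>\<^sup>2 * (\<gamma> + \<epsilon>\<^sub>0)\<^sup>2 * C\<^sub>3 * (1 + 2 ^ 3 * K\<^sub>h ^ 4 + 2 ^ 9 * (x ^ 4 + fact 4 / \<gamma> ^ 4))
      * (L\<^sub>1 * L\<^sub>0\<^sup>2 + 2 * M / \<epsilon>\<^sub>0\<^sup>2) * (log 2 T + 1))"
proof -
  interpret brownian \<P> F B
    using space BM by (rule brownian.intro)
  have \<gamma>: "0 < \<gamma>"
    using parameters by linarith
  let ?c = "C_cost h \<gamma>"
  define \<kappa> where "\<kappa> = L\<^sub>1 * L\<^sub>0\<^sup>2 + 2 * M / \<epsilon>\<^sub>0\<^sup>2"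
  have c_nonneg: "0 \<le> ?c r" for r
    using h \<gamma> by (intro C_cost_nonneg) (auto simp: holding_cost_def)
  have M_nonneg: "0 \<le> M"
    using c_nonneg[of 0] M[of 0] K\<^sub>h(1) by simp
  have L\<^sub>1_nonneg: "0 \<le> L\<^sub>1"
  proof -
    have "0 \<le> L\<^sub>1 * \<delta>\<^sub>0\<^sup>2"
      using L\<^sub>1[of "rstar + \<delta>\<^sub>0"] pos by simp
    then show ?thesis
      using pos by (simp add: zero_le_mult_iff)
  qed
  have \<kappa>: "0 \<le> \<kappa>"
    using M_nonneg L\<^sub>1_nonneg by (simp add: \<kappa>_def)
  \<comment> \<open>Near \<open>\<gamma>\<close> the excess cost is quadratic in the error; far from it, it is at most \<open>2 M\<close>, and the cut-off error is \<open>\<epsilon>\<^sub>0\<close>.\<close>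
  have cost: "\<bar>?c (r_opt h u) - ?c rstar\<bar> \<le> \<kappa> * (min \<bar>u - \<gamma>\<bar> \<epsilon>\<^sub>0)\<^sup>2" if u: "\<gamma>low \<le> u" for u
  proof (cases "\<bar>u - \<gamma>\<bar> < \<epsilon>\<^sub>0")
    case True
    then have "u \<in> {\<gamma> - \<epsilon>\<^sub>0 <..< \<gamma> + \<epsilon>\<^sub>0} \<inter> {\<gamma>low..}" "\<gamma> \<in> {\<gamma> - \<epsilon>\<^sub>0 <..< \<gamma> + \<epsilon>\<^sub>0} \<inter> {\<gamma>low..}"
      using u parameters(5) pos(1) by auto
    from L\<^sub>0[OF this] have near: "r_opt h u \<in> {rstar - \<delta>\<^sub>0 <..< rstar + \<delta>\<^sub>0}"
      "\<bar>r_opt h u - rstar\<bar> \<le> L\<^sub>0 * \<bar>u - \<gamma>\<bar>"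
      by (simp_all add: rstar)
    have "\<bar>?c (r_opt h u) - ?c rstar\<bar> \<le> L\<^sub>1 * (r_opt h u - rstar)\<^sup>2"
      using L\<^sub>1[of "r_opt h u"] near(1) by auto
    also have "\<dots> \<le> L\<^sub>1 * (L\<^sub>0 * \<bar>u - \<gamma>\<bar>)\<^sup>2"
      using near(2) L\<^sub>1_nonneg by (intro mult_left_mono) (metis abs_ge_zero power2_abs power_mono)
    also have "\<dots> = (L\<^sub>1 * L\<^sub>0\<^sup>2) * (min \<bar>u - \<gamma>\<bar> \<epsilon>\<^sub>0)\<^sup>2"
      using True by (simp add: power_mult_distrib)
    also have "\<dots> \<le> \<kappa> * (min \<bar>u - \<gamma>\<bar> \<epsilon>\<^sub>0)\<^sup>2"
      using M_nonneg by (intro mult_right_mono) (auto simp: \<kappa>_def)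
    finally show ?thesis .
  next
    case False
    have "?c (r_opt h u) \<le> M" "?c rstar \<le> M"
      using K\<^sub>h(2)[of u] K\<^sub>h(2)[of \<gamma>] u parameters(5) by (auto intro!: M simp: rstar)
    then have "\<bar>?c (r_opt h u) - ?c rstar\<bar> \<le> 2 * M"
      using c_nonneg[of "r_opt h u"] c_nonneg[of rstar] M_nonneg by linarith
    also have "\<dots> = (2 * M / \<epsilon>\<^sub>0\<^sup>2) * (min \<bar>u - \<gamma>\<bar> \<epsilon>\<^sub>0)\<^sup>2"
      using False pos by (simp add: min_def)
    also have "\<dots> \<le> \<kappa> * (min \<bar>u - \<gamma>\<bar> \<epsilon>\<^sub>0)\<^sup>2"
      using L\<^sub>1_nonneg by (intro mult_right_mono) (auto simp: \<kappa>_def)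
    finally show ?thesis .
  qed
  have rhat: "rhat k \<omega> \<in> {- K\<^sub>h..0}" if \<omega>: "\<omega> \<in> space \<P>" for k \<omega>
  proof (cases k)
    case 0
    then show ?thesis
      using AU \<omega> K\<^sub>h(1) by (simp add: AU_algorithm_def)
  next
    case (Suc j)
    then have "rhat k \<omega> = r_opt h (\<gamma>hat k \<omega>)" "\<gamma>low \<le> \<gamma>hat k \<omega>"
      using AU \<omega> by (auto simp: AU_algorithm_def)
    then show ?thesis
      using K\<^sub>h(2)[of "\<gamma>hat k \<omega>"] by auto
  qed
  define Q where "Q = 1 + 2 ^ 3 * K\<^sub>h ^ 4 + 2 ^ 9 * (x ^ 4 + fact 4 / \<gamma> ^ 4)"
  have Q: "0 \<le> Q"
    using \<gamma> x K\<^sub>h(1) by (simp add: Q_def)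
  define \<rho> where "\<rho> = \<kappa> * (\<gamma> * (\<gamma> + \<epsilon>\<^sub>0))\<^sup>2"
  have \<rho>: "0 \<le> \<rho>"
    using \<kappa> by (simp add: \<rho>_def)
  \<comment> \<open>\<open>D\<close> is the deviation of the time average over period \<open>j\<close>, which determines the barrier of period \<open>Suc j\<close>.\<close>
  have "\<exists>D\<in>borel_measurable \<P>. (\<forall>\<omega>\<in>space \<P>. \<bar>?c (rhat (Suc j) \<omega>) - ?c rstar\<bar> \<le> \<rho> * (D \<omega>)\<^sup>2) \<and>
      (\<integral>\<^sup>+ \<omega>. ennreal ((D \<omega>)\<^sup>2) \<partial>\<P>) \<le> ennreal (C\<^sub>3 * (Q / dtau j))" for j
  proof -
    obtain Zk Yk where RBM: "reflected_BM F B \<theta> \<sigma> (space \<P>) (tau j) (X j) (rhat j) Zk Yk"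
      and ghat: "\<And>\<omega>. \<omega> \<in> space \<P> \<Longrightarrow> \<gamma>hat (Suc j) \<omega> =
        max (inverse (1 / dtau j * (LBINT t:{tau j..<tau j + dtau j}. Zk t \<omega> - rhat j \<omega>))) \<gamma>low"
      and rh: "\<And>\<omega>. \<omega> \<in> space \<P> \<Longrightarrow> rhat (Suc j) \<omega> = r_opt h (\<gamma>hat (Suc j) \<omega>)"
      by (rule AU_period[OF AU, of j]) blast
    have d: "0 < dtau j" "1 \<le> dtau j"
      using dtau_ge_1[of j] by linarith+
    define A where "A \<omega> = 1 / dtau j * (LBINT t:{tau j..<tau j + dtau j}. Zk t \<omega> - rhat j \<omega>)" for \<omega>
    have [measurable]: "A \<in> borel_measurable \<P>"
      unfolding A_def using RBM tau_nonneg d(1) by (rule time_average_measurable)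
    show ?thesis
    proof (intro bexI[of _ "\<lambda>\<omega>. \<bar>A \<omega> - 1 / \<gamma>\<bar>"] conjI ballI)
      fix \<omega> assume \<omega>: "\<omega> \<in> space \<P>"
      have A_nonneg: "0 \<le> A \<omega>"
        unfolding A_def set_lebesgue_integral_def
        using d(1) reflected_path.ge_barrier[OF reflected_BM_path[OF RBM \<omega>]]
        by (intro mult_nonneg_nonneg integral_nonneg) (auto simp: indicator_def)
      have "min \<bar>\<gamma>hat (Suc j) \<omega> - \<gamma>\<bar> \<epsilon>\<^sub>0 \<le> \<gamma> * (\<gamma> + \<epsilon>\<^sub>0) * \<bar>A \<omega> - 1 / \<gamma>\<bar>"
        using A_nonneg parameters(4,5) pos(1) ghat[OF \<omega>] unfolding A_def[symmetric]
        by (rule estimate_error_le)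
      then have "(min \<bar>\<gamma>hat (Suc j) \<omega> - \<gamma>\<bar> \<epsilon>\<^sub>0)\<^sup>2 \<le> (\<gamma> * (\<gamma> + \<epsilon>\<^sub>0) * \<bar>A \<omega> - 1 / \<gamma>\<bar>)\<^sup>2"
        using pos(1) by (intro power_mono) auto
      then have "\<kappa> * (min \<bar>\<gamma>hat (Suc j) \<omega> - \<gamma>\<bar> \<epsilon>\<^sub>0)\<^sup>2 \<le> \<rho> * \<bar>A \<omega> - 1 / \<gamma>\<bar>\<^sup>2"
        using \<kappa> unfolding \<rho>_def by (simp add: power_mult_distrib mult.assoc mult_left_mono)
      moreover have "\<gamma>low \<le> \<gamma>hat (Suc j) \<omega>"
        by (simp add: ghat[OF \<omega>])
      ultimately show "\<bar>?c (rhat (Suc j) \<omega>) - ?c rstar\<bar> \<le> \<rho> * \<bar>A \<omega> - 1 / \<gamma>\<bar>\<^sup>2"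
        unfolding rh[OF \<omega>] using cost by (blast intro: order_trans)
    next
      have "(\<integral>\<^sup>+ \<omega>. ennreal (\<bar>A \<omega> - 1 / \<gamma>\<bar>\<^sup>2) \<partial>\<P>)
        \<le> (\<integral>\<^sup>+ \<omega>. ennreal (C\<^sub>3 * (1 + \<bar>X j \<omega>\<bar> ^ 4) / dtau j) \<partial>\<P>)"
        unfolding A_def
      proof (rule time_average_bound_from_random_start[where g = "\<lambda>a. \<bar>a - 1 / \<gamma>\<bar>\<^sup>2"
            and R = "{- K\<^sub>h..0}" and b = "\<lambda>y. ennreal (C\<^sub>3 * (1 + \<bar>y\<bar> ^ 4) / dtau j)",
            OF RBM tau_nonneg d(1) _ rhat])
        show "continuous_on UNIV (\<lambda>a. \<bar>a - 1 / \<gamma>\<bar>\<^sup>2)"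
          by (intro continuous_intros)
        fix r0 y0 Zr Yr
        assume r0: "r0 \<in> {- K\<^sub>h..0}" "r0 \<le> y0"
          and Zr: "reflected_BM F B \<theta> \<sigma> (space \<P>) 0 (\<lambda>_. y0) (\<lambda>_. r0) Zr Yr"
        have "(LBINT t:{0..<dtau j}. Zr t \<omega> - r0) = (LBINT t:{0..dtau j}. Zr t \<omega> - r0)"
          if "\<omega> \<in> space \<P>" for \<omega>
        proof (rule set_integral_Ico_eq_Icc)
          have "continuous_on {0..} (\<lambda>t. Zr t \<omega>)"
            using Zr that by (auto simp: reflected_BM_def)
          then show "continuous_on {0..dtau j} (\<lambda>t. Zr t \<omega> - r0)"
            by (intro continuous_intros) (rule continuous_on_subset, auto)
        qed
        then have "(\<integral>\<^sup>+ \<omega>. ennreal (\<bar>1 / dtau j * (LBINT t:{0..<dtau j}. Zr t \<omega> - r0) - 1 / \<gamma>\<bar>\<^sup>2) \<partial>\<P>)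
          = (\<integral>\<^sup>+ \<omega>. ennreal (\<bar>1 / dtau j * (LBINT t:{0..dtau j}. Zr t \<omega> - r0) - 1 / \<gamma>\<bar>\<^sup>2) \<partial>\<P>)"
          by (intro nn_integral_cong) simp
        also have "\<dots> \<le> ennreal (C\<^sub>3 * (1 + \<bar>y0\<bar> ^ 4) / dtau j)"
          using r0 d(2) Zr by (rule C\<^sub>3)
        finally show "(\<integral>\<^sup>+ \<omega>. ennreal (\<bar>1 / dtau j * (LBINT t:{0..<dtau j}. Zr t \<omega> - r0) - 1 / \<gamma>\<bar>\<^sup>2) \<partial>\<P>)
          \<le> ennreal (C\<^sub>3 * (1 + \<bar>y0\<bar> ^ 4) / dtau j)" .
      qed
      also have "\<dots> = (\<integral>\<^sup>+ \<omega>. ennreal (C\<^sub>3 / dtau j) * ennreal (1 + \<bar>X j \<omega>\<bar> ^ 4) \<partial>\<P>)"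
        by (intro nn_integral_cong) (subst ennreal_mult''[symmetric], auto)
      also have "\<dots> = ennreal (C\<^sub>3 / dtau j) * (\<integral>\<^sup>+ \<omega>. ennreal (1 + \<bar>X j \<omega>\<bar> ^ 4) \<partial>\<P>)"
      proof (rule nn_integral_cmult)
        have [measurable]: "X j \<in> borel_measurable \<P>"
          using RBM tau_nonneg[of j] by (auto simp: reflected_BM_def intro: measurable_F_M)
        show "(\<lambda>\<omega>. ennreal (1 + \<bar>X j \<omega>\<bar> ^ 4)) \<in> borel_measurable \<P>"
          by measurable
      qed
      also have "\<dots> \<le> ennreal (C\<^sub>3 / dtau j) * ennreal Q"
      proof (rule mult_left_mono)
        have "(\<integral>\<^sup>+ \<omega>. ennreal (1 + \<bar>X j \<omega>\<bar> ^ 4) \<partial>\<P>)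
          \<le> ennreal (1 + K\<^sub>h ^ 4 + 8 * (x ^ 4 + fact 4 / \<gamma> ^ 4))"
          using AU parameters(2,3) \<gamma> x rhat by (rule AU_state_fourth_moment)
        also have "\<dots> \<le> ennreal Q"
          using K\<^sub>h(1) \<gamma> unfolding Q_def
          by (intro ennreal_leI add_mono mult_right_mono) (auto simp: zero_le_mult_iff)
        finally show "(\<integral>\<^sup>+ \<omega>. ennreal (1 + \<bar>X j \<omega>\<bar> ^ 4) \<partial>\<P>) \<le> ennreal Q" .
      qed simp
      also have "\<dots> = ennreal (C\<^sub>3 * (Q / dtau j))"
        using Q by (simp add: ennreal_mult''[symmetric])
      finally show "(\<integral>\<^sup>+ \<omega>. ennreal (\<bar>A \<omega> - 1 / \<gamma>\<bar>\<^sup>2) \<partial>\<P>) \<le> ennreal (C\<^sub>3 * (Q / dtau j))" .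
    qed measurable
  qed
  then obtain D where [measurable]: "\<And>j. D j \<in> borel_measurable \<P>"
    and D_cost: "\<And>j \<omega>. \<omega> \<in> space \<P> \<Longrightarrow> \<bar>?c (rhat (Suc j) \<omega>) - ?c rstar\<bar> \<le> \<rho> * (D j \<omega>)\<^sup>2"
    and D_mean: "\<And>j. (\<integral>\<^sup>+ \<omega>. ennreal ((D j \<omega>)\<^sup>2) \<partial>\<P>) \<le> ennreal (C\<^sub>3 * (Q / dtau j))"
    by metis
  define N where "N = nat \<lfloor>log 2 (T + 1)\<rfloor>"
  have N: "real N \<le> log 2 T + 1"
  proof -
    have "0 \<le> log 2 (T + 1)"
      using T by simp
    then have "real N \<le> log 2 (T + 1)"
      by (simp add: N_def)
    also have "\<dots> \<le> log 2 (2 * T)"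
      using T by simp
    also have "\<dots> = log 2 T + 1"
      using T by (subst log_mult) auto
    finally show ?thesis .
  qed
  have "R3_AU \<P> h \<gamma> rhat T \<le> (\<integral>\<^sup>+ \<omega>. (\<Sum>j<N. ennreal (\<rho> * dtau (Suc j)) * ennreal ((D j \<omega>)\<^sup>2)) \<partial>\<P>)"
    unfolding R3_AU_def N_def[symmetric] rstar[symmetric]
  proof (rule nn_integral_mono)
    fix \<omega> assume \<omega>: "\<omega> \<in> space \<P>"
    have "(\<Sum>k = 1..N. LBINT t:{tau k..<tau (Suc k)}. \<bar>?c (rhat k \<omega>) - ?c rstar\<bar>)
      = (\<Sum>j<N. dtau (Suc j) * \<bar>?c (rhat (Suc j) \<omega>) - ?c rstar\<bar>)"
      unfolding One_nat_def sum.atLeast1_atMost_eq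
    proof (rule sum.cong)
      fix j
      show "(LBINT t:{tau (Suc j)..<tau (Suc (Suc j))}. \<bar>?c (rhat (Suc j) \<omega>) - ?c rstar\<bar>)
        = dtau (Suc j) * \<bar>?c (rhat (Suc j) \<omega>) - ?c rstar\<bar>"
        using dtau_ge_1[of "Suc j"]
        by (simp add: set_lebesgue_integral_def tau_Suc[of "Suc j"])
    qed simp
    also have "\<dots> \<le> (\<Sum>j<N. \<rho> * dtau (Suc j) * (D j \<omega>)\<^sup>2)"
    proof (rule sum_mono)
      fix j
      have "dtau (Suc j) * \<bar>?c (rhat (Suc j) \<omega>) - ?c rstar\<bar> \<le> dtau (Suc j) * (\<rho> * (D j \<omega>)\<^sup>2)"
        using dtau_ge_1[of "Suc j"] by (intro mult_left_mono D_cost \<omega>) auto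
      then show "dtau (Suc j) * \<bar>?c (rhat (Suc j) \<omega>) - ?c rstar\<bar> \<le> \<rho> * dtau (Suc j) * (D j \<omega>)\<^sup>2"
        by (simp add: algebra_simps)
    qed
    finally have "ennreal (\<Sum>k = 1..N. LBINT t:{tau k..<tau (Suc k)}. \<bar>?c (rhat k \<omega>) - ?c rstar\<bar>)
      \<le> ennreal (\<Sum>j<N. \<rho> * dtau (Suc j) * (D j \<omega>)\<^sup>2)"
      by (rule ennreal_leI)
    also have "\<dots> = (\<Sum>j<N. ennreal (\<rho> * dtau (Suc j) * (D j \<omega>)\<^sup>2))"
      using \<rho> by (intro sum_ennreal[symmetric]) (simp add: dtau_def)
    finally show "ennreal (\<Sum>k = 1..N. LBINT t:{tau k..<tau (Suc k)}. \<bar>?c (rhat k \<omega>) - ?c rstar\<bar>)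
      \<le> (\<Sum>j<N. ennreal (\<rho> * dtau (Suc j)) * ennreal ((D j \<omega>)\<^sup>2))"
      by (simp add: ennreal_mult''[symmetric])
  qed
  also have "\<dots> = (\<Sum>j<N. ennreal (\<rho> * dtau (Suc j)) * (\<integral>\<^sup>+ \<omega>. ennreal ((D j \<omega>)\<^sup>2) \<partial>\<P>))"
    by (simp add: nn_integral_sum nn_integral_cmult)
  also have "\<dots> \<le> (\<Sum>j<N. ennreal (\<rho> * dtau (Suc j)) * ennreal (C\<^sub>3 * (Q / dtau j)))"
    by (intro sum_mono mult_left_mono D_mean) auto
  \<comment> \<open>The length \<open>dtau (Suc j)\<close> of a period is twice that of the period in which its barrier was estimated.\<close>
  also have "\<dots> = (\<Sum>j<N. ennreal (C\<^sub>3 * (2 * \<rho> * Q)))"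
  proof (rule sum.cong)
    fix j
    have "ennreal (\<rho> * dtau (Suc j)) * ennreal (C\<^sub>3 * (Q / dtau j))
      = ennreal ((\<rho> * dtau (Suc j)) * (C\<^sub>3 * (Q / dtau j)))"
      using \<rho> by (intro ennreal_mult'[symmetric]) (simp add: dtau_def)
    also have "(\<rho> * dtau (Suc j)) * (C\<^sub>3 * (Q / dtau j)) = C\<^sub>3 * (2 * \<rho> * Q)"
      by (simp add: dtau_def)
    finally show "ennreal (\<rho> * dtau (Suc j)) * ennreal (C\<^sub>3 * (Q / dtau j)) = ennreal (C\<^sub>3 * (2 * \<rho> * Q))" .
  qed simp
  also have "\<dots> = ennreal (real N) * ennreal (C\<^sub>3 * (2 * \<rho> * Q))"
    by (simp add: ennreal_of_nat_eq_real_of_nat)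
  also have "\<dots> \<le> ennreal (log 2 T + 1) * ennreal (C\<^sub>3 * (2 * \<rho> * Q))"
    using N by (intro mult_right_mono ennreal_leI) auto
  also have "\<dots> = ennreal ((log 2 T + 1) * (C\<^sub>3 * (2 * \<rho> * Q)))"
    using T by (intro ennreal_mult'[symmetric]) simp
  also have "(log 2 T + 1) * (C\<^sub>3 * (2 * \<rho> * Q))
    = 2 * \<gamma>\<^sup>2 * (\<gamma> + \<epsilon>\<^sub>0)\<^sup>2 * C\<^sub>3 * Q * \<kappa> * (log 2 T + 1)"
    by (simp add: \<rho>_def power_mult_distrib)
  finally show ?thesis
    unfolding Q_def \<kappa>_def .
qed

end
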